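(* Let $K_W$ be the linear Gaussian transition with potential $W(x,y)=-\log g_\tau(y-(\alpha+\beta x))$, and let $\mu(dx)=e^{-U(x)}\lambda(dx)$, $\eta(dx)=e^{-V(x)}\lambda(dx)$ be probability measures on $\mathbb{R}^d$ whose potentials satisfy, for some $a_u,a_v>0$, $b_u,b_v\ge0$, $\delta_u,\delta_v\ge0$ and all $x\in\mathbb{R}^d$, $$\nabla^2U(x)\ge a_u 1_{\|x\|\ge\delta_u}I-b_u1_{\|x\|<\delta_u}I,\qquad \nabla^2V(x)\ge a_v1_{\|x\|\ge\delta_v}I-b_v1_{\|x\|<\delta_v}I.$$ Let $P_{\mu,\eta}$ be the Schrödinger bridge from $\mu$ to $\eta$ with respect to $P=\mu\times K_W$, with backward disintegration $P_{\mu,\eta}(d(x,y))=\eta(dy)\,\mathcal{L}^{\flat}_{\eta,\mu}(y,dx)$, let $\mathcal{P}_{2n+1}(d(x,y))=\eta(dy)\,\mathcal{K}_{2n+1}(y,dx)$ be the odd-indexed Sinkhorn bridges started at $\mathcal{P}_0=P$, and let $\rho_u$ be the constant described in the context. Then for any $n\ge0$, $$\|m_{2n+1}-m_{\eta,\mu}\|_{2,\eta}^2\le2\rho_u\,\mathcal{H}(P_{\mu,\eta}\,|\,\mathcal{P}_{2n+1}),$$ $$\|\sigma_{2n+1}-\sigma_{\eta,\mu}\|_{1,\eta}\le4\rho_u\,\mathcal{H}(P_{\mu,\eta}\,|\,\mathcal{P}_{2n+1})+c_{\eta,\mu}\bigl(8\rho_u\,\mathcal{H}(P_{\mu,\eta}\,|\,\mathcal{P}_{2n+1})\bigr)^{1/2},$$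 where $c_{\eta,\mu}\ge0$ is defined by $c_{\eta,\mu}^2:=\int\eta(dx)\,\mathrm{Tr}(\sigma_{\eta,\mu}(x))$.
   Context: Notation. $\lambda$ is Lebesgue measure on $\mathbb{R}^d$; $g_\tau$ is the density of the centered Gaussian on $\mathbb{R}^d$ with covariance matrix $\tau>0$ (positive definite); $\alpha\in\mathbb{R}^d$; $\beta\in\mathbb{R}^{d\times d}$ is invertible; $K_W(x,dy)=e^{-W(x,y)}\lambda(dy)$. The potentials $U,V$ are twice differentiable. Inequalities between symmetric matrices are in the Loewner order. For a Markov transition $\mathcal{K}$: $(\mu\times\mathcal{K})(d(x,y))=\mu(dx)\mathcal{K}(x,dy)$, $m_{\mathcal{K}}(x)=\int\mathcal{K}(x,dy)y$ and $\sigma_{\mathcal{K}}(x)=\int\mathcal{K}(x,dy)(y-m_{\mathcal{K}}(x))(y-m_{\mathcal{K}}(x))^{\prime}$ ($^{\prime}$ is transposition). Put $m_{\eta,\mu}=m_{\mathcal{L}^{\flat}_{\eta,\mu}}$, $\sigma_{\eta,\mu}=\sigma_{\mathcal{L}^{\flat}_{\eta,\mu}}$, $m_{2n+1}=m_{\mathcal{K}_{2n+1}}$, $\sigma_{2n+1}=\sigma_{\mathcal{K}_{2n+1}}$. The relative entropy is $\mathcal{H}(\mu\,|\,\eta)=\int\log(d\mu/d\eta)d\mu$ if $\mu\ll\eta$, and $\infty$ otherwise. For measurable matrix- or vector-valued $v$, $\|v\|_{p,\eta}^p=\int\eta(dx)\|v(x)\|_F^p$ with $\|v\|_F=\sqrt{\mathrm{Tr}(v^{\prime}v)}$.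 Bridges. $\Pi(\mu,\eta)$ is the set of probability measures on $\mathbb{R}^d\times\mathbb{R}^d$ with marginals $\mu$ (first) and $\eta$ (second). With $P=\mu\times K_W$, the Schrödinger bridge is $P_{\mu,\eta}=\mathrm{argmin}_{Q\in\Pi(\mu,\eta)}\mathcal{H}(Q\,|\,P)$; it is assumed that some $Q\in\Pi(\mu,\eta)$ has $\mathcal{H}(Q\,|\,P)<\infty$. Sinkhorn bridges: $\mathcal{P}_0=P$, i.e. $\mathcal{K}_0=K_W$; $\mathcal{P}_{2n}(d(x,y))=\mu(dx)\mathcal{K}_{2n}(x,dy)$ and $\mathcal{P}_{2n+1}(d(x,y))=\eta(dy)\mathcal{K}_{2n+1}(y,dx)$, where $\mathcal{K}_{2n+1}$ is the $\mathcal{P}_{2n}$-conditional distribution of the first coordinate given the second and $\mathcal{K}_{2(n+1)}$ is the $\mathcal{P}_{2n+1}$-conditional distribution of the second coordinate given the first. (Equivalently $\mathcal{P}_{2n+1}$ minimizes $\mathcal{H}(\cdot\,|\,\mathcal{P}_{2n})$ among measures with second marginal $\eta$, and $\mathcal{P}_{2(n+1)}$ minimizes $\mathcal{H}(\cdot\,|\,\mathcal{P}_{2n+1})$ among measures with first marginal $\mu$.) Constant $\rho_u$. A probability measure $\mu$ satisfies $LS(\rho)$ if $\mathcal{H}(\nu\,|\,\mu)\le\frac{\rho}{2}\int\|\nabla\log(d\nu/d\mu)\|^2d\nu$ for all probability measures $\nu$ (right-hand side $\infty$ if $\nu\not\ll\mu$); it satisfies $\mathbb{T}_2(\rho)$ if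 $\frac12\mathcal{D}_2(\nu,\mu)^2\le\rho\,\mathcal{H}(\nu\,|\,\mu)$ for all $\nu$, where $\mathcal{D}_2$ is the 2-Wasserstein distance; $LS(\rho)$ implies $\mathbb{T}_2(\rho)$. A Markov transition satisfies one of these if all measures $\mathcal{K}(x,\cdot)$ do. It is known that the curvature condition on $U$ ensures that $\mathcal{L}^{\flat}_{\eta,\mu}$, all $\mathcal{K}_{2n+1}$ with $n\ge0$, and $\mu$ satisfy $LS(\rho_u)$, and thus $\mathbb{T}_2(\rho_u)$, for some $\rho_u>0$ depending on $(a_u,b_u,\delta_u)$ (with $\rho_u=1/a_u$ allowed when $\delta_u=0$); $\rho_u$ denotes such a constant. *)

theory Defs
  imports "HOL-Probability.Probability"
begin

definition grad :: "('a::real_inner \<Rightarrow> real) \<Rightarrow> 'a \<Rightarrow> 'a" where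
  "grad f x = (THE g. GDERIV f x :> g)"

definition hessian :: "(real^'d \<Rightarrow> real) \<Rightarrow> real^'d \<Rightarrow> real^'d^'d" where
  "hessian f x = matrix (frechet_derivative (grad f) (at x))"

definition twice_differentiable :: "(real^'d \<Rightarrow> real) \<Rightarrow> bool" where
  "twice_differentiable f \<longleftrightarrow>
     (\<forall>x. f differentiable (at x)) \<and> (\<forall>x. grad f differentiable (at x))"

definition loewner_le :: "real^'d^'d \<Rightarrow> real^'d^'d \<Rightarrow> bool" where
  "loewner_le A B \<longleftrightarrow> (\<forall>v. v \<bullet> (A *v v) \<le> v \<bullet> (B *v v))"

definition pos_definite :: "real^'d^'d \<Rightarrow> bool" where
  "pos_definite A \<longleftrightarrow> transpose A = A \<and> (\<forall>v. v \<noteq> 0 \<longrightarrow> 0 < v \<bullet> (A *v v))"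

definition curvature_bound :: "real \<Rightarrow> real \<Rightarrow> real \<Rightarrow> (real^'d \<Rightarrow> real) \<Rightarrow> bool" where
  "curvature_bound a b \<delta> U \<longleftrightarrow>
     (\<forall>x. loewner_le
        (mat (a * indicator {z. \<delta> \<le> norm z} x - b * indicator {z. norm z < \<delta>} x))
        (hessian U x))"

definition frobenius_norm :: "real^'d^'d \<Rightarrow> real" where
  "frobenius_norm A = sqrt (trace (transpose A ** A))"

definition gibbs_measure :: "('a::euclidean_space \<Rightarrow> real) \<Rightarrow> 'a measure" where
  "gibbs_measure U = density lborel (\<lambda>x. ennreal (exp (- U x)))"

definition gauss_density :: "real^'d^'d \<Rightarrow> real^'d \<Rightarrow> real" where
  "gauss_density \<tau> z =
     exp (- (z \<bullet> (matrix_inv \<tau> *v z)) / 2) / sqrt ((2 * pi) ^ CARD('d) * det \<tau>)"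

definition gauss_potential ::
  "real^'d^'d \<Rightarrow> real^'d \<Rightarrow> real^'d^'d \<Rightarrow> real^'d \<Rightarrow> real^'d \<Rightarrow> real" where
  "gauss_potential \<tau> \<alpha> \<beta> x y = - ln (gauss_density \<tau> (y - (\<alpha> + \<beta> *v x)))"

definition potential_kernel ::
  "('a::euclidean_space \<Rightarrow> 'a \<Rightarrow> real) \<Rightarrow> 'a \<Rightarrow> 'a measure" where
  "potential_kernel W x = gibbs_measure (W x)"

text \<open>For probability measures \<open>\<nu> \<ll> \<mu>\<close> the negative part of \<open>ln (d\<nu>/d\<mu>)\<close> is
  \<open>\<nu>\<close>-integrable, so non-integrability means that the entropy is infinite.\<close>

definition rel_entropy :: "'a measure \<Rightarrow> 'a measure \<Rightarrow> ennreal" where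
  "rel_entropy \<nu> \<mu> =
     (if absolutely_continuous \<mu> \<nu> \<and> integrable \<nu> (entropy_density (exp 1) \<mu> \<nu>)
      then ennreal (KL_divergence (exp 1) \<mu> \<nu>) else \<infinity>)"

text \<open>The right-hand side of the log-Sobolev inequality is read as infinite unless \<open>d\<nu>/d\<mu>\<close> has
  an everywhere differentiable version \<open>f\<close>.  Zeros of \<open>f\<close>, where \<open>ln f\<close> is meaningless, form
  a \<open>\<nu>\<close>-null set and do not contribute to the integral.\<close>

definition log_sobolev :: "real \<Rightarrow> ('a::euclidean_space) measure \<Rightarrow> bool" where
  "log_sobolev \<rho> \<mu> \<longleftrightarrow>
     (\<forall>\<nu> f. prob_space \<nu> \<longrightarrow> (\<forall>x. 0 \<le> f x) \<longrightarrow> (\<forall>x. f differentiable (at x)) \<longrightarrow>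
        \<nu> = density \<mu> (\<lambda>x. ennreal (f x)) \<longrightarrow>
        rel_entropy \<nu> \<mu>
          \<le> ennreal (\<rho> / 2) * (\<integral>\<^sup>+x. ennreal ((norm (grad (\<lambda>z. ln (f z)) x))\<^sup>2) \<partial>\<nu>))"

definition markov_kernel :: "('a::topological_space \<Rightarrow> 'a measure) \<Rightarrow> bool" where
  "markov_kernel K \<longleftrightarrow> K \<in> borel \<rightarrow>\<^sub>M prob_algebra borel"

definition forward_prod ::
  "('a::topological_space) measure \<Rightarrow> ('a \<Rightarrow> 'a measure) \<Rightarrow> ('a \<times> 'a) measure" where
  "forward_prod \<mu> K = \<mu> \<bind> (\<lambda>x. distr (K x) (borel \<Otimes>\<^sub>M borel) (\<lambda>y. (x, y)))"

text \<open>The base measure \<open>\<eta>\<close> lives on the second coordinate: this is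
  \<open>\<eta>(dy) L(y,dx)\<close> as a law of \<open>(x,y)\<close>.\<close>

definition backward_prod ::
  "('a::topological_space) measure \<Rightarrow> ('a \<Rightarrow> 'a measure) \<Rightarrow> ('a \<times> 'a) measure" where
  "backward_prod \<eta> L = \<eta> \<bind> (\<lambda>y. distr (L y) (borel \<Otimes>\<^sub>M borel) (\<lambda>x. (x, y)))"

definition forward_conditional ::
  "('a::topological_space \<times> 'a) measure \<Rightarrow> ('a \<Rightarrow> 'a measure) \<Rightarrow> bool" where
  "forward_conditional Q K \<longleftrightarrow> markov_kernel K \<and> Q = forward_prod (distr Q borel fst) K"

definition backward_conditional ::
  "('a::topological_space \<times> 'a) measure \<Rightarrow> ('a \<Rightarrow> 'a measure) \<Rightarrow> bool" where
  "backward_conditional Q L \<longleftrightarrow> markov_kernel L \<and> Q = backward_prod (distr Q borel snd) L"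

definition kernel_mean :: "('a \<Rightarrow> (real^'d) measure) \<Rightarrow> 'a \<Rightarrow> real^'d" where
  "kernel_mean K x = (\<integral>y. y \<partial>K x)"

definition kernel_cov :: "('a \<Rightarrow> (real^'d) measure) \<Rightarrow> 'a \<Rightarrow> real^'d^'d" where
  "kernel_cov K x =
     (\<integral>y. (\<chi> i j. (y - kernel_mean K x) $ i * (y - kernel_mean K x) $ j) \<partial>K x)"

definition couplings ::
  "('a::topological_space) measure \<Rightarrow> 'a measure \<Rightarrow> ('a \<times> 'a) measure set" where
  "couplings \<mu> \<eta> =
     {Q. sets Q = sets (borel \<Otimes>\<^sub>M borel) \<and> prob_space Q \<and>
         distr Q borel fst = \<mu> \<and> distr Q borel snd = \<eta>}"

definition schroedinger_bridge ::
  "('a::topological_space) measure \<Rightarrow> 'a measure \<Rightarrow> ('a \<times> 'a) measure \<Rightarrow> ('a \<times> 'a) measure \<Rightarrow> bool"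
  where
  "schroedinger_bridge \<mu> \<eta> P Q \<longleftrightarrow>
     is_arg_min (\<lambda>R. rel_entropy R P) (\<lambda>R. R \<in> couplings \<mu> \<eta>) Q"

definition sinkhorn_bridge ::
  "('a::topological_space) measure \<Rightarrow> 'a measure \<Rightarrow> (nat \<Rightarrow> 'a \<Rightarrow> 'a measure) \<Rightarrow> nat \<Rightarrow>
     ('a \<times> 'a) measure" where
  "sinkhorn_bridge \<mu> \<eta> K n =
     (if even n then forward_prod \<mu> (K n) else backward_prod \<eta> (K n))"

text \<open>Conditional laws are unique only up to null sets, so the Sinkhorn transitions are specified
  by a predicate rather than by a recursive function.\<close>

definition sinkhorn_kernels ::
  "('a::topological_space) measure \<Rightarrow> 'a measure \<Rightarrow> ('a \<Rightarrow> 'a measure) \<Rightarrow>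
     (nat \<Rightarrow> 'a \<Rightarrow> 'a measure) \<Rightarrow> bool" where
  "sinkhorn_kernels \<mu> \<eta> K0 K \<longleftrightarrow>
     K 0 = K0 \<and>
     (\<forall>n. backward_conditional (sinkhorn_bridge \<mu> \<eta> K (2 * n)) (K (2 * n + 1))) \<and>
     (\<forall>n. forward_conditional (sinkhorn_bridge \<mu> \<eta> K (2 * n + 1)) (K (2 * (n + 1))))"

definition ennreal_sqrt :: "ennreal \<Rightarrow> ennreal" where
  "ennreal_sqrt r = (if r = \<infinity> then \<infinity> else ennreal (sqrt (enn2real r)))"

definition cov_const ::
  "(real^'d) measure \<Rightarrow> (real^'d \<Rightarrow> (real^'d) measure) \<Rightarrow> ennreal" where
  "cov_const \<eta> L = ennreal_sqrt (\<integral>\<^sup>+y. ennreal (trace (kernel_cov L y)) \<partial>\<eta>)"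

end

theory Submission
  imports Defs
begin

text \<open>Both estimates compare the conditional laws \<open>L y\<close> and \<open>k y = K (2 * n + 1) y\<close> of the first
coordinate given the second, under two measures with the same second marginal \<open>\<eta>\<close>.  In
transport terms: the \<open>\<T>\<^sub>2\<close> inequality of \<open>k y\<close> bounds the Wasserstein distance
of \<open>L y\<close> and \<open>k y\<close> by their relative entropy, the chain rule says that these entropies average to
the entropy of the joint laws, and means and covariances are controlled by any coupling.

The proof below is the dual form of this argument, in which no coupling and no density
of \<open>L y\<close> with respect to \<open>k y\<close> appears.  The Donsker--Varadhan inequality, applied on the product
space, shows that \<open>\<integral> (\<integral> g(x,y) L(y,dx))\<^sup>+ \<eta>(dy) \<le> \<H>\<close> for each \<open>g\<close> with
\<open>\<integral> e\<^bsup>g(x,y)\<^esup> k(y,dx) \<le> 1\<close> for all \<open>y\<close> (\<open>rel_entropy_backward_prod_dual\<close>).  It remains to exhibit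
functions \<open>g\<close> that see the mean and the covariance.

Such functions come from the Hamilton--Jacobi argument of Bobkov, Gentil and Ledoux.  If
\<open>\<partial>\<^sub>t q + |\<nabla>q|\<^sup>2/2 \<le> 0\<close>, then the log-Sobolev inequality for the law with density proportional
to \<open>exp (t q\<^sub>t/\<rho>)\<close> shows that \<open>t \<mapsto> (1/t) ln \<integral> exp (t q\<^sub>t/\<rho>) dk\<close> decreases, whence
\<open>\<integral> exp (q\<^sub>1/\<rho>) dk \<le> exp (\<integral> q\<^sub>0 dk/\<rho>)\<close> (\<open>log_sobolev_Hamilton_Jacobi\<close>).  Two explicit subsolutions
are enough.

\<^item> For \<open>q\<^sub>t(x) = x \<bullet> v - t |v|\<^sup>2/2\<close> one gets sub-Gaussian exponential moments, hence finite
  second moments, and, with \<open>v\<close> the difference of the two means, the bound on means.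

\<^item> With \<open>z = x - c\<close>, a symmetric \<open>A\<close> with \<open>\<parallel>A\<parallel> \<le> 1\<close> and \<open>0 < s < 1\<close>, take
  \<open>q\<^sub>t(x) = (s/2) z \<bullet> A z - (\<kappa>\<^sub>t/2) |z|\<^sup>2\<close>.  Since \<open>|\<nabla>q\<^sub>t| \<le> (s + \<kappa>\<^sub>t) |z|\<close>, this is a subsolution
  when \<open>\<kappa>' = (s + \<kappa>)\<^sup>2\<close>, and \<open>\<kappa>\<^sub>0 = 0\<close> gives \<open>s + \<kappa>\<^sub>t = s/(1 - s t)\<close>.  Centring at the mean of
  \<open>L y\<close> and letting \<open>A\<close> be the normalised difference of the covariances yields the bound on
  covariances up to the choice of \<open>s\<close>.  Centring both quadratic functions at the same point costs
  one more squared distance of the means, which turns \<open>2 \<rho> \<H>\<close> into \<open>4 \<rho> \<H>\<close>; optimising over \<open>s\<close>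
  produces the square root.\<close>

section \<open>Differentiation under the integral sign\<close>

text \<open>Dominated convergence: by the mean value theorem on the convex set \<open>S\<close>, the majorant \<open>W\<close> of the
derivatives also bounds the difference quotients.\<close>

lemma has_real_derivative_integral:
  fixes h h' :: "real \<Rightarrow> 'a \<Rightarrow> real"
  assumes S: "convex S" "t\<^sub>0 \<in> S"
    and int: "\<And>t. t \<in> S \<Longrightarrow> integrable M (h t)"
    and der: "\<And>t x. t \<in> S \<Longrightarrow> ((\<lambda>t. h t x) has_real_derivative h' t x) (at t within S)"
    and bound: "\<And>t x. t \<in> S \<Longrightarrow> \<bar>h' t x\<bar> \<le> W x"
    and W: "integrable M W"
    and meas: "h' t\<^sub>0 \<in> borel_measurable M"
  shows "((\<lambda>t. \<integral>x. h t x \<partial>M) has_real_derivative (\<integral>x. h' t\<^sub>0 x \<partial>M)) (at t\<^sub>0 within S)"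
  unfolding has_field_derivative_iff tendsto_at_iff_sequentially
proof (intro allI impI)
  fix X :: "nat \<Rightarrow> real"
  assume XS: "\<forall>i. X i \<in> S - {t\<^sub>0}" and X: "X \<longlonglongrightarrow> t\<^sub>0"
  have "(\<lambda>i. \<integral>x. (h (X i) x - h t\<^sub>0 x) / (X i - t\<^sub>0) \<partial>M) \<longlonglongrightarrow> (\<integral>x. h' t\<^sub>0 x \<partial>M)"
  proof (rule integral_dominated_convergence[OF meas _ W])
    show "(\<lambda>x. (h (X i) x - h t\<^sub>0 x) / (X i - t\<^sub>0)) \<in> borel_measurable M" for i
      using int[of "X i"] int[of t\<^sub>0] XS S by (auto dest!: borel_measurable_integrable)
    show "AE x in M. (\<lambda>i. (h (X i) x - h t\<^sub>0 x) / (X i - t\<^sub>0)) \<longlonglongrightarrow> h' t\<^sub>0 x"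
    proof (rule AE_I2)
      fix x
      show "(\<lambda>i. (h (X i) x - h t\<^sub>0 x) / (X i - t\<^sub>0)) \<longlonglongrightarrow> h' t\<^sub>0 x"
        using der[OF S(2), of x] X XS
        unfolding has_field_derivative_iff tendsto_at_iff_sequentially by (auto simp: o_def)
    qed
    show "AE x in M. norm ((h (X i) x - h t\<^sub>0 x) / (X i - t\<^sub>0)) \<le> W x" for i
    proof (rule AE_I2)
      fix x
      have "norm (h (X i) x - h t\<^sub>0 x) \<le> W x * norm (X i - t\<^sub>0)"
        by (rule field_differentiable_bound[OF S(1) der]) (use bound XS S(2) in auto)
      then show "norm ((h (X i) x - h t\<^sub>0 x) / (X i - t\<^sub>0)) \<le> W x"
        using XS[rule_format, of i] by (simp add: divide_le_eq)
    qed
  qed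
  moreover have "(\<integral>x. (h (X i) x - h t\<^sub>0 x) / (X i - t\<^sub>0) \<partial>M)
      = ((\<integral>x. h (X i) x \<partial>M) - (\<integral>x. h t\<^sub>0 x \<partial>M)) / (X i - t\<^sub>0)" for i
    using int[of "X i"] int[of t\<^sub>0] XS S by (simp add: Bochner_Integration.integral_diff)
  ultimately have "(\<lambda>i. ((\<integral>x. h (X i) x \<partial>M) - (\<integral>x. h t\<^sub>0 x \<partial>M)) / (X i - t\<^sub>0)) \<longlonglongrightarrow> (\<integral>x. h' t\<^sub>0 x \<partial>M)"
    by (simp only:)
  then show "((\<lambda>t. ((\<integral>x. h t x \<partial>M) - (\<integral>x. h t\<^sub>0 x \<partial>M)) / (t - t\<^sub>0)) \<circ> X) \<longlonglongrightarrow> (\<integral>x. h' t\<^sub>0 x \<partial>M)"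
    by (simp add: o_def)
qed

section \<open>Exponential tilts under a log-Sobolev inequality\<close>

lemma grad_eqI: "GDERIV f x :> D \<Longrightarrow> grad f x = D"
proof -
  assume f: "GDERIV f x :> D"
  show ?thesis
    unfolding grad_def
  proof (rule the_equality, rule f)
    fix g assume "GDERIV f x :> g"
    then have "(\<lambda>h. h \<bullet> g) = (\<lambda>h. h \<bullet> D)"
      using f unfolding gderiv_def by (rule has_derivative_unique)
    then show "g = D"
      by (metis inner_commute vector_eq_ldot)
  qed
qed

lemma measurable_if_GDERIV:
  assumes "\<And>x. GDERIV h x :> D x"
  shows "h \<in> borel_measurable borel"
  using assms unfolding gderiv_def
  by (intro borel_measurable_continuous_onI continuous_at_imp_continuous_on)
    (auto intro: has_derivative_continuous)

text \<open>The log-Sobolev inequality for the law with density \<open>exp h / Z\<close>: its relative entropy is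
\<open>\<integral> h exp h / Z - ln Z\<close>, and the gradient of the log-density is \<open>D\<close>.  The gradient enters only
through an integrable majorant \<open>G\<close> of \<open>|D|\<^sup>2\<close>, which is the form in which a Hamilton--Jacobi
inequality controls it.\<close>

lemma log_sobolev_exponential_tilt:
  fixes k :: "'a::euclidean_space measure"
  assumes k: "prob_space k" "sets k = sets borel" "log_sobolev \<rho> k" "0 \<le> \<rho>"
    and h: "\<And>x. GDERIV h x :> D x" "\<And>x. \<bar>h x\<bar> \<le> B"
    and G: "integrable k G" "\<And>x. (norm (D x))\<^sup>2 \<le> G x"
  shows "(\<integral>x. h x * exp (h x) \<partial>k) - (\<integral>x. exp (h x) \<partial>k) * ln (\<integral>x. exp (h x) \<partial>k)
    \<le> \<rho> / 2 * (\<integral>x. G x * exp (h x) \<partial>k)"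
proof -
  interpret prob_space k by fact
  note [measurable_cong] = k(2)
  have hm: "h \<in> borel_measurable borel"
    using h(1) by (rule measurable_if_GDERIV)
  then have [measurable]: "h \<in> borel_measurable k"
    by simp
  have [measurable]: "G \<in> borel_measurable k"
    using G(1) by simp
  have G0: "0 \<le> G x" for x
    using G(2)[of x] by (rule order_trans[rotated]) simp
  define Z where "Z = (\<integral>x. exp (h x) \<partial>k)"
  have hB: "h x \<le> B" "- B \<le> h x" for x
    using h(2)[of x] by auto
  have exp_int: "integrable k (\<lambda>x. exp (h x))"
    by (rule integrable_const_bound[of _ "exp B"]) (use hB in auto)
  have hexp_int: "integrable k (\<lambda>x. h x * exp (h x))"
    by (rule integrable_const_bound[of _ "B * exp B"])
      (use hB h(2) in \<open>auto simp: abs_mult intro!: AE_I2 mult_mono order_trans[OF abs_ge_zero h(2)]\<close>)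
  have Gexp_int: "integrable k (\<lambda>x. G x * exp (h x))"
  proof (rule Bochner_Integration.integrable_bound)
    show "integrable k (\<lambda>x. exp B * G x)"
      using G by simp
    show "AE x in k. norm (G x * exp (h x)) \<le> norm (exp B * G x)"
      by (rule AE_I2) (use hB in \<open>auto simp: abs_mult mult.commute[of "exp B"] intro!: mult_left_mono\<close>)
  qed simp
  have "exp (- B) * 1 \<le> Z"
    unfolding Z_def
    using integral_mono[OF _ exp_int, of "\<lambda>_. exp (- B)"] hB by (simp add: prob_space)
  then have Z: "0 < Z"
    using exp_gt_zero[of "- B"] by linarith
  define f where "f x = exp (h x) / Z" for x
  have f: "f x > 0" for x
    using Z by (simp add: f_def)
  have [measurable]: "f \<in> borel_measurable k"
    unfolding f_def by simp
  have lnf: "ln (f x) = h x - ln Z" for x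
    using Z by (simp add: f_def ln_div)
  define \<nu> where "\<nu> = density k (\<lambda>x. ennreal (f x))"
  have "(\<integral>\<^sup>+x. f x \<partial>k) = ennreal (\<integral>x. f x \<partial>k)"
    by (rule nn_integral_eq_integral) (use f exp_int in \<open>auto simp: f_def less_imp_le\<close>)
  also have "(\<integral>x. f x \<partial>k) = 1"
    using Z by (simp add: f_def Z_def)
  finally have \<nu>: "prob_space \<nu>"
    unfolding \<nu>_def by (intro prob_spaceI) (simp add: emeasure_density)
  have gradf: "grad (\<lambda>z. ln (f z)) x = D x" for x
    unfolding lnf using GDERIV_diff[OF h(1)[of x] GDERIV_const[of "ln Z" x]] by (intro grad_eqI) simp
  have "f differentiable (at x)" for x
    unfolding f_def
    using has_derivative_exp[OF h(1)[unfolded gderiv_def, of x]] Z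
    by (intro differentiable_divide differentiable_const) (auto simp: differentiable_def)
  then have "rel_entropy \<nu> k
      \<le> ennreal (\<rho> / 2) * (\<integral>\<^sup>+x. ennreal ((norm (grad (\<lambda>z. ln (f z)) x))\<^sup>2) \<partial>\<nu>)"
    using k(3) \<nu> f unfolding log_sobolev_def by (auto simp: less_imp_le \<nu>_def)
  also have "\<dots> \<le> ennreal (\<rho> / 2) * (\<integral>\<^sup>+x. ennreal (G x) \<partial>\<nu>)"
    unfolding gradf using G(2) by (intro mult_left_mono nn_integral_mono ennreal_leI) auto
  also have "(\<integral>\<^sup>+x. ennreal (G x) \<partial>\<nu>) = (\<integral>\<^sup>+x. ennreal (G x * exp (h x) / Z) \<partial>k)"
    using G0 unfolding \<nu>_def by (subst nn_integral_density)
        (auto simp: f_def ennreal_mult'[symmetric] mult.commute intro!: nn_integral_cong)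
  also have "\<dots> = ennreal ((\<integral>x. G x * exp (h x) \<partial>k) / Z)"
    using G0 Z Gexp_int by (subst nn_integral_eq_integral) auto
  also have "ennreal (\<rho> / 2) * \<dots> = ennreal (\<rho> / 2 * ((\<integral>x. G x * exp (h x) \<partial>k) / Z))"
    by (rule ennreal_mult'[symmetric]) (use k(4) in simp)
  finally have le: "rel_entropy \<nu> k \<le> ennreal (\<rho> / 2 * ((\<integral>x. G x * exp (h x) \<partial>k) / Z))" .
  then have "ennreal (KL_divergence (exp 1) k \<nu>) \<le> ennreal (\<rho> / 2 * ((\<integral>x. G x * exp (h x) \<partial>k) / Z))"
    unfolding rel_entropy_def by (auto split: if_splits simp: top_unique)
  moreover have "0 \<le> \<rho> / 2 * ((\<integral>x. G x * exp (h x) \<partial>k) / Z)"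
    using G0 Z k(4) by simp
  ultimately have "KL_divergence (exp 1) k \<nu> \<le> \<rho> / 2 * ((\<integral>x. G x * exp (h x) \<partial>k) / Z)"
    by (simp add: ennreal_le_iff)
  moreover have "KL_divergence (exp 1) k \<nu> = (\<integral>x. f x * ln (f x) \<partial>k)"
    unfolding \<nu>_def by (subst KL_density) (use f in \<open>auto simp: less_imp_le log_ln\<close>)
  moreover have "\<dots> = ((\<integral>x. h x * exp (h x) \<partial>k) - Z * ln Z) / Z"
  proof -
    have "(\<integral>x. f x * ln (f x) \<partial>k) = (\<integral>x. (h x * exp (h x) - ln Z * exp (h x)) / Z \<partial>k)"
      unfolding lnf by (intro Bochner_Integration.integral_cong)
        (auto simp: f_def algebra_simps diff_divide_distrib)
    also have "\<dots> = ((\<integral>x. h x * exp (h x) \<partial>k) - Z * ln Z) / Z"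
      using hexp_int exp_int by (simp add: Z_def mult.commute)
    finally show ?thesis .
  qed
  ultimately have "((\<integral>x. h x * exp (h x) \<partial>k) - Z * ln Z) / Z \<le> (\<rho> / 2 * (\<integral>x. G x * exp (h x) \<partial>k)) / Z"
    by simp
  then show ?thesis
    using Z unfolding Z_def[symmetric] by (simp only: divide_le_cancel split: if_splits)
qed

section \<open>Hamilton--Jacobi subsolutions\<close>

text \<open>With \<open>N t = \<integral> exp (t q\<^sub>t/\<rho>)\<close>, the log-Sobolev inequality and the Hamilton--Jacobi inequality combine
to \<open>t N' t \<le> N t ln (N t)\<close>, that is, \<open>ln (N t) / t\<close> decreases.  Its limit at \<open>0\<close> is
\<open>N' 0 = \<integral> q\<^sub>0/\<rho>\<close>.\<close>

lemma log_sobolev_Hamilton_Jacobi_bounded: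
  fixes k :: "'a::euclidean_space measure" and q q' :: "real \<Rightarrow> 'a \<Rightarrow> real"
  assumes k: "prob_space k" "sets k = sets borel" "log_sobolev \<rho> k" "0 < \<rho>"
    and grad: "\<And>t x. t \<in> {0..1} \<Longrightarrow> GDERIV (q t) x :> Dq t x"
    and der: "\<And>t x. t \<in> {0..1} \<Longrightarrow>
      ((\<lambda>t. q t x) has_real_derivative q' t x) (at t within {0..1})"
    and HJ: "\<And>t x. t \<in> {0..1} \<Longrightarrow> q' t x + (norm (Dq t x))\<^sup>2 / 2 \<le> 0"
    and meas: "\<And>t. t \<in> {0..1} \<Longrightarrow> q' t \<in> borel_measurable borel"
    and bound: "\<And>t x. t \<in> {0..1} \<Longrightarrow> \<bar>q' t x\<bar> \<le> W x" "integrable k W"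
    and B: "\<And>t x. t \<in> {0..1} \<Longrightarrow> \<bar>q t x\<bar> \<le> B"
  shows "(\<integral>x. exp (q 1 x / \<rho>) \<partial>k) \<le> exp ((\<integral>x. q 0 x \<partial>k) / \<rho>)"
proof -
  interpret prob_space k by fact
  note [measurable_cong] = k(2)
  note \<rho> = k(4)
  have qm[measurable]: "t \<in> {0..1} \<Longrightarrow> q t \<in> borel_measurable k" for t
    using measurable_if_GDERIV[OF grad, of t] k(2) by simp
  have q'm[measurable]: "t \<in> {0..1} \<Longrightarrow> q' t \<in> borel_measurable k" for t
    using meas[of t] k(2) by simp
  have q'_int: "integrable k (q' t)" if "t \<in> {0..1}" for t
    by (rule Bochner_Integration.integrable_bound[OF bound(2)])
      (use that bound(1)[OF that] in \<open>auto intro!: AE_I2 intro: order_trans[OF _ abs_ge_self]\<close>)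
  have q_int: "integrable k (q t)" if "t \<in> {0..1}" for t
    by (rule integrable_const_bound[of _ B]) (use that B[OF that] in auto)
  have B0: "0 \<le> B"
    using B[of 0] by (meson abs_ge_zero atLeastAtMost_iff order.refl order.trans zero_le_one)
  define h where "h t x = t * q t x / \<rho>" for t x
  have hB: "\<bar>h t x\<bar> \<le> B / \<rho>" if "t \<in> {0..1}" for t x
  proof -
    have "\<bar>t * q t x\<bar> \<le> 1 * B"
      unfolding abs_mult using that B[OF that, of x] by (intro mult_mono) auto
    then show ?thesis
      using \<rho> by (simp add: h_def divide_right_mono)
  qed
  have exp_hB: "exp (h t x) \<le> exp (B / \<rho>)" if "t \<in> {0..1}" for t x
    using hB[OF that, of x] by auto
  have hm[measurable]: "t \<in> {0..1} \<Longrightarrow> h t \<in> borel_measurable k" for t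
    unfolding h_def by simp
  have exp_int: "integrable k (\<lambda>x. exp (h t x))" if "t \<in> {0..1}" for t
    by (rule integrable_const_bound[of _ "exp (B / \<rho>)"]) (use that exp_hB in auto)
  have mult_exp_int: "integrable k (\<lambda>x. f x * exp (h t x))"
    if t: "t \<in> {0..1}" and f: "integrable k f" for t and f :: "'a \<Rightarrow> real"
  proof (rule Bochner_Integration.integrable_bound)
    show "integrable k (\<lambda>x. exp (B / \<rho>) * f x)"
      using f by simp
    show "AE x in k. norm (f x * exp (h t x)) \<le> norm (exp (B / \<rho>) * f x)"
      by (rule AE_I2) (use exp_hB[OF t] in \<open>auto simp: abs_mult mult.commute[of "exp (B / \<rho>)"] intro!: mult_left_mono\<close>)
    show "(\<lambda>x. f x * exp (h t x)) \<in> borel_measurable k"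
      using f t by measurable
  qed
  define N where "N t = (\<integral>x. exp (h t x) \<partial>k)" for t
  define N' where "N' t = (\<integral>x. (q t x + t * q' t x) / \<rho> * exp (h t x) \<partial>k)" for t
  have N: "0 < N t" if "t \<in> {0..1}" for t
  proof -
    have "- (B / \<rho>) \<le> h t x" for x
      using hB[OF that, of x] by auto
    then have "exp (- (B / \<rho>)) * 1 \<le> N t"
      unfolding N_def using integral_mono[OF _ exp_int[OF that], of "\<lambda>_. exp (- (B / \<rho>))"]
      by (simp add: prob_space)
    then show ?thesis
      using exp_gt_zero[of "- (B / \<rho>)"] by linarith
  qed
  have N_der: "(N has_real_derivative N' t) (at t within {0..1})" if t: "t \<in> {0..1}" for t
    unfolding N_def[abs_def] N'_def
  proof (rule has_real_derivative_integral[OF _ t])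
    show "integrable k (\<lambda>x. exp (B / \<rho>) * ((B + W x) / \<rho>))"
      using bound(2) by simp
    show "\<bar>(q s x + s * q' s x) / \<rho> * exp (h s x)\<bar> \<le> exp (B / \<rho>) * ((B + W x) / \<rho>)"
      if s: "s \<in> {0..1}" for s x
    proof -
      have "\<bar>s * q' s x\<bar> \<le> 1 * W x"
        unfolding abs_mult using s bound(1)[OF s, of x] by (intro mult_mono) auto
      then have "\<bar>q s x + s * q' s x\<bar> \<le> B + W x"
        using B[OF s, of x] by linarith
      moreover from this have "0 \<le> B + W x"
        by (rule order_trans[OF abs_ge_zero])
      ultimately show ?thesis
        unfolding abs_mult mult.commute[of "exp (B / \<rho>)"] using exp_hB[OF s, of x] \<rho>
        by (intro mult_mono) (auto intro!: divide_right_mono)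
    qed
    show "((\<lambda>t. exp (h t x)) has_real_derivative (q s x + s * q' s x) / \<rho> * exp (h s x))
        (at s within {0..1})" if s: "s \<in> {0..1}" for s x
      unfolding h_def using der[OF s, of x]
      by (auto intro!: derivative_eq_intros simp: \<rho>[THEN less_imp_neq, symmetric] field_simps)
  qed (use exp_int t in auto)
  have key: "t * N' t \<le> N t * ln (N t)" if t: "t \<in> {0..1}" for t
  proof -
    have "(\<integral>x. h t x * exp (h t x) \<partial>k) - N t * ln (N t)
        \<le> \<rho> / 2 * (\<integral>x. (- 2 * (t / \<rho>)\<^sup>2 * q' t x) * exp (h t x) \<partial>k)"
      unfolding N_def
    proof (rule log_sobolev_exponential_tilt[OF k(1-3) less_imp_le[OF \<rho>] _ hB[OF t]])
      show "GDERIV (h t) x :> (t / \<rho>) *\<^sub>R Dq t x" for x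
        unfolding h_def using GDERIV_mult[OF GDERIV_const grad[OF t], of "t / \<rho>" x] by simp
      show "integrable k (\<lambda>x. - 2 * (t / \<rho>)\<^sup>2 * q' t x)"
        using q'_int[OF t] by simp
      \<comment> \<open>The Hamilton--Jacobi inequality bounds the gradient by the time derivative.\<close>
      show "(norm ((t / \<rho>) *\<^sub>R Dq t x))\<^sup>2 \<le> - 2 * (t / \<rho>)\<^sup>2 * q' t x" for x
        using mult_left_mono[OF HJ[OF t, of x], of "2 * (t / \<rho>)\<^sup>2"]
        by (simp add: power_mult_distrib power_divide algebra_simps)
    qed
    also have "\<dots> = - (t\<^sup>2 / \<rho>) * (\<integral>x. q' t x * exp (h t x) \<partial>k)"
      using \<rho> by (simp add: mult.assoc power2_eq_square)
    finally have *: "(\<integral>x. h t x * exp (h t x) \<partial>k) + t\<^sup>2 / \<rho> * (\<integral>x. q' t x * exp (h t x) \<partial>k)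
        \<le> N t * ln (N t)"
      by simp
    have "t * N' t = (\<integral>x. h t x * exp (h t x) + t\<^sup>2 / \<rho> * (q' t x * exp (h t x)) \<partial>k)"
      unfolding N'_def h_def
      by (subst integral_mult_right_zero[symmetric], intro Bochner_Integration.integral_cong)
        (auto simp: field_simps power2_eq_square add_divide_distrib)
    also have "\<dots> = (\<integral>x. h t x * exp (h t x) \<partial>k) + t\<^sup>2 / \<rho> * (\<integral>x. q' t x * exp (h t x) \<partial>k)"
    proof -
      have "integrable k (h t)"
        unfolding h_def using q_int[OF t] by simp
      then show ?thesis
        using mult_exp_int[OF t] q'_int[OF t] by simp
    qed
    finally show ?thesis
      using * by simp
  qed
  have dec: "ln (N 1) / 1 \<le> ln (N e) / e" if e: "0 < e" "e < 1" for e
  proof (rule DERIV_nonpos_imp_decreasing_open[where f = "\<lambda>t. ln (N t) / t"])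
    show "e \<le> 1" using e by simp
    fix t assume t: "e < t" "t < 1"
    have "(N has_real_derivative N' t) (at t)"
      using N_der[of t] at_within_interior[of t "{0..1}"] t e by simp
    then have "((\<lambda>t. ln (N t) / t) has_real_derivative (t * N' t - N t * ln (N t)) / (N t * t\<^sup>2)) (at t)"
      using N[of t] t e by (auto intro!: derivative_eq_intros simp: field_simps power2_eq_square)
    moreover have "(t * N' t - N t * ln (N t)) / (N t * t\<^sup>2) \<le> 0"
      using key[of t] N[of t] t e by (intro divide_nonpos_nonneg) auto
    ultimately show "\<exists>y. ((\<lambda>t. ln (N t) / t) has_real_derivative y) (at t) \<and> y \<le> 0"
      by blast
  next
    have "continuous_on {0..1} N"
      using N_der by (intro DERIV_continuous_on)
    then have "continuous_on {e..1} N"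
      by (rule continuous_on_subset) (use e in auto)
    then show "continuous_on {e..1} (\<lambda>t. ln (N t) / t)"
      using e by (intro continuous_intros) (auto simp: less_imp_neq[OF N, symmetric])
  qed
  have N0: "N 0 = 1"
    by (simp add: N_def h_def prob_space)
  have "((\<lambda>t. ln (N t)) has_real_derivative N' 0) (at 0 within {0..1})"
    using N_der[of 0] by (auto intro!: derivative_eq_intros simp: N0)
  then have "((\<lambda>t. ln (N t) / t) \<longlongrightarrow> N' 0) (at_right 0)"
    by (simp add: has_field_derivative_iff N0 at_within_Icc_at_right)
  moreover have "eventually (\<lambda>t. ln (N 1) \<le> ln (N t) / t) (at_right 0)"
    using dec by (auto simp: eventually_at_right_field intro!: exI[of _ 1])
  ultimately have "ln (N 1) \<le> N' 0"
    by (rule tendsto_lowerbound) simp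
  then have "N 1 \<le> exp (N' 0)"
    using exp_le_cancel_iff[of "ln (N 1)" "N' 0"] N[of 1] by simp
  then show ?thesis
    by (simp add: N_def N'_def h_def)
qed

text \<open>Composition with an increasing function of slope at most \<open>1\<close> preserves the Hamilton--Jacobi
inequality, because the gradient term is quadratic and the time derivative is nonpositive.  The
bounded functions below have this property and increase in modulus to the identity as
\<open>R\<close> tends to infinity, so that they reduce the general case to the bounded one.\<close>

definition soft_truncation :: "real \<Rightarrow> real \<Rightarrow> real" where
  "soft_truncation R u = R * arctan (u / R)"

lemma soft_truncation_deriv:
  "R \<noteq> 0 \<Longrightarrow> (soft_truncation R has_real_derivative inverse (1 + (u / R)\<^sup>2)) (at u within S)"
  unfolding soft_truncation_def[abs_def] by (auto intro!: derivative_eq_intros)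

lemma inverse_one_plus_square: "0 < inverse (1 + (u::real)\<^sup>2)" "inverse (1 + u\<^sup>2) \<le> 1"
  by (auto simp: add_pos_nonneg inverse_le_1_iff)

lemma abs_soft_truncation_le: "R > 0 \<Longrightarrow> \<bar>soft_truncation R u\<bar> \<le> R * (pi / 2)"
  unfolding soft_truncation_def abs_mult
  using arctan_bounded[of "u / R"] by (intro mult_mono) auto

lemma abs_soft_truncation_le_self: "R > 0 \<Longrightarrow> \<bar>soft_truncation R u\<bar> \<le> \<bar>u\<bar>"
  unfolding soft_truncation_def abs_mult
  using mult_left_mono[OF abs_arctan_le[of "u / R"], of R] by simp

lemma tendsto_soft_truncation: "(\<lambda>n. soft_truncation (real (Suc n)) u) \<longlonglongrightarrow> u"
proof (cases "u = 0")
  case False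
  have "((\<lambda>x. (arctan x - arctan 0) / (x - 0)) \<longlongrightarrow> 1) (at 0)"
    using DERIV_arctan[of 0] unfolding has_field_derivative_iff by simp
  moreover have "filterlim (\<lambda>n. u / real (Suc n)) (at 0) sequentially"
    unfolding filterlim_at using False lim_const_over_n[THEN LIMSEQ_Suc, of u] by auto
  ultimately have "(\<lambda>n. arctan (u / real (Suc n)) / (u / real (Suc n))) \<longlonglongrightarrow> 1"
    by (auto dest: filterlim_compose)
  then have "(\<lambda>n. u * (arctan (u / real (Suc n)) / (u / real (Suc n)))) \<longlonglongrightarrow> u * 1"
    by (intro tendsto_intros)
  then show ?thesis
    using False by (simp add: soft_truncation_def mult.commute del: of_nat_Suc)
qed (simp add: soft_truncation_def)

lemma soft_truncation_measurable[measurable]: "soft_truncation R \<in> borel_measurable borel"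
  unfolding soft_truncation_def[abs_def] by measurable

lemma log_sobolev_Hamilton_Jacobi_truncated:
  fixes k :: "'a::euclidean_space measure" and q q' :: "real \<Rightarrow> 'a \<Rightarrow> real"
  assumes k: "prob_space k" "sets k = sets borel" "log_sobolev \<rho> k" "0 < \<rho>"
    and grad: "\<And>t x. t \<in> {0..1} \<Longrightarrow> GDERIV (q t) x :> Dq t x"
    and der: "\<And>t x. t \<in> {0..1} \<Longrightarrow>
      ((\<lambda>t. q t x) has_real_derivative q' t x) (at t within {0..1})"
    and HJ: "\<And>t x. t \<in> {0..1} \<Longrightarrow> q' t x + (norm (Dq t x))\<^sup>2 / 2 \<le> 0"
    and meas: "\<And>t. t \<in> {0..1} \<Longrightarrow> q' t \<in> borel_measurable borel"
    and bound: "\<And>t x. t \<in> {0..1} \<Longrightarrow> \<bar>q' t x\<bar> \<le> W x" "integrable k W"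
    and R: "0 < R"
  shows "(\<integral>x. exp (soft_truncation R (q 1 x) / \<rho>) \<partial>k)
    \<le> exp ((\<integral>x. soft_truncation R (q 0 x) \<partial>k) / \<rho>)"
proof -
  define \<theta> where "\<theta> t x = inverse (1 + (q t x / R)\<^sup>2)" for t x
  have \<theta>: "0 < \<theta> t x" "\<theta> t x \<le> 1" for t x
    unfolding \<theta>_def by (rule inverse_one_plus_square)+
  show ?thesis
  proof (rule log_sobolev_Hamilton_Jacobi_bounded[OF k, where
        q = "\<lambda>t x. soft_truncation R (q t x)" and Dq = "\<lambda>t x. \<theta> t x *\<^sub>R Dq t x" and
        q' = "\<lambda>t x. \<theta> t x * q' t x" and W = W and B = "R * (pi / 2)"])
    fix t x assume t: "t \<in> {0..1::real}"
    show "GDERIV (\<lambda>x. soft_truncation R (q t x)) x :> \<theta> t x *\<^sub>R Dq t x"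
      using GDERIV_DERIV_compose[OF grad[OF t] soft_truncation_deriv] R by (simp add: \<theta>_def)
    show "((\<lambda>t. soft_truncation R (q t x)) has_real_derivative \<theta> t x * q' t x) (at t within {0..1})"
      using DERIV_chain2[OF soft_truncation_deriv der[OF t], of R] R by (simp add: \<theta>_def)
    \<comment> \<open>The gradient term carries the factor \<open>\<theta>\<^sup>2 \<le> \<theta>\<close>.\<close>
    have "\<theta> t x * q' t x + (norm (\<theta> t x *\<^sub>R Dq t x))\<^sup>2 / 2
        = \<theta> t x * (q' t x + \<theta> t x * ((norm (Dq t x))\<^sup>2 / 2))"
      by (simp add: power_mult_distrib power2_eq_square algebra_simps)
    also have "\<theta> t x * ((norm (Dq t x))\<^sup>2 / 2) \<le> 1 * ((norm (Dq t x))\<^sup>2 / 2)"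
      using \<theta> by (intro mult_right_mono) auto
    then have "\<theta> t x * (q' t x + \<theta> t x * ((norm (Dq t x))\<^sup>2 / 2)) \<le> 0"
      using HJ[OF t, of x] \<theta>[of t x] by (intro mult_nonneg_nonpos) auto
    finally show "\<theta> t x * q' t x + (norm (\<theta> t x *\<^sub>R Dq t x))\<^sup>2 / 2 \<le> 0" .
    have "\<bar>\<theta> t x * q' t x\<bar> \<le> 1 * W x"
      unfolding abs_mult using \<theta>[of t x] bound(1)[OF t, of x] by (intro mult_mono) auto
    then show "\<bar>\<theta> t x * q' t x\<bar> \<le> W x"
      by simp
    show "\<bar>soft_truncation R (q t x)\<bar> \<le> R * (pi / 2)"
      using R by (rule abs_soft_truncation_le)
  next
    fix t assume t: "t \<in> {0..1::real}"
    have [measurable]: "q t \<in> borel_measurable borel" "q' t \<in> borel_measurable borel"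
      using measurable_if_GDERIV[OF grad[OF t]] meas[OF t] by simp_all
    show "(\<lambda>x. \<theta> t x * q' t x) \<in> borel_measurable borel"
      unfolding \<theta>_def by measurable
  qed fact
qed

text \<open>The truncated inequalities pass to the limit by dominated convergence at time \<open>0\<close> and by Fatou's
lemma at time \<open>1\<close>.  In particular the integral on the left is shown to be finite.\<close>

theorem log_sobolev_Hamilton_Jacobi:
  fixes k :: "'a::euclidean_space measure" and q q' :: "real \<Rightarrow> 'a \<Rightarrow> real"
  assumes k: "prob_space k" "sets k = sets borel" "log_sobolev \<rho> k" "0 < \<rho>"
    and grad: "\<And>t x. t \<in> {0..1} \<Longrightarrow> GDERIV (q t) x :> Dq t x"
    and der: "\<And>t x. t \<in> {0..1} \<Longrightarrow>
      ((\<lambda>t. q t x) has_real_derivative q' t x) (at t within {0..1})"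
    and HJ: "\<And>t x. t \<in> {0..1} \<Longrightarrow> q' t x + (norm (Dq t x))\<^sup>2 / 2 \<le> 0"
    and meas: "\<And>t. t \<in> {0..1} \<Longrightarrow> q' t \<in> borel_measurable borel"
    and bound: "\<And>t x. t \<in> {0..1} \<Longrightarrow> \<bar>q' t x\<bar> \<le> W x" "integrable k W"
    and q0: "integrable k (q 0)"
  shows "(\<integral>\<^sup>+x. ennreal (exp (q 1 x / \<rho>)) \<partial>k) \<le> ennreal (exp ((\<integral>x. q 0 x \<partial>k) / \<rho>))"
proof -
  interpret prob_space k by fact
  note [measurable_cong] = k(2)
  define T where "T n = soft_truncation (real (Suc n))" for n
  have [measurable]: "q 1 \<in> borel_measurable borel" "T n \<in> borel_measurable borel" for n
    using measurable_if_GDERIV[OF grad[of 1]] by (simp_all add: T_def)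
  have T: "(\<lambda>n. T n u) \<longlonglongrightarrow> u" for u
    unfolding T_def by (rule tendsto_soft_truncation)
  have step: "(\<integral>\<^sup>+x. ennreal (exp (T n (q 1 x) / \<rho>)) \<partial>k) \<le> ennreal (exp ((\<integral>x. T n (q 0 x) \<partial>k) / \<rho>))" for n
  proof -
    have "integrable k (\<lambda>x. exp (T n (q 1 x) / \<rho>))"
    proof (rule integrable_const_bound[of _ "exp (real (Suc n) * (pi / 2) / \<rho>)"])
      have "T n (q 1 x) / \<rho> \<le> real (Suc n) * (pi / 2) / \<rho>" for x
        using abs_soft_truncation_le[of "real (Suc n)" "q 1 x"] k(4)
        unfolding T_def by (intro divide_right_mono) auto
      then show "AE x in k. norm (exp (T n (q 1 x) / \<rho>)) \<le> exp (real (Suc n) * (pi / 2) / \<rho>)"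
        by simp
    qed simp
    then have "(\<integral>\<^sup>+x. ennreal (exp (T n (q 1 x) / \<rho>)) \<partial>k) = ennreal (\<integral>x. exp (T n (q 1 x) / \<rho>) \<partial>k)"
      by (intro nn_integral_eq_integral) auto
    also have "\<dots> \<le> ennreal (exp ((\<integral>x. T n (q 0 x) \<partial>k) / \<rho>))"
      unfolding T_def
      by (intro ennreal_leI log_sobolev_Hamilton_Jacobi_truncated[OF k grad der HJ meas bound]) auto
    finally show ?thesis .
  qed
  have "(\<lambda>n. \<integral>x. T n (q 0 x) \<partial>k) \<longlonglongrightarrow> (\<integral>x. q 0 x \<partial>k)"
  proof (rule integral_dominated_convergence[where w = "\<lambda>x. \<bar>q 0 x\<bar>"])
    show "AE x in k. norm (T n (q 0 x)) \<le> \<bar>q 0 x\<bar>" for n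
      using abs_soft_truncation_le_self[of "real (Suc n)"] by (simp add: T_def)
  qed (use q0 T in auto)
  then have lim: "(\<lambda>n. ennreal (exp ((\<integral>x. T n (q 0 x) \<partial>k) / \<rho>))) \<longlonglongrightarrow> ennreal (exp ((\<integral>x. q 0 x \<partial>k) / \<rho>))"
    using k(4) by (intro tendsto_intros tendsto_ennrealI) auto
  have "(\<integral>\<^sup>+x. ennreal (exp (q 1 x / \<rho>)) \<partial>k)
      = (\<integral>\<^sup>+x. liminf (\<lambda>n. ennreal (exp (T n (q 1 x) / \<rho>))) \<partial>k)"
  proof (rule nn_integral_cong)
    fix x
    have "(\<lambda>n. ennreal (exp (T n (q 1 x) / \<rho>))) \<longlonglongrightarrow> ennreal (exp (q 1 x / \<rho>))"
      using k(4) T[of "q 1 x"] by (intro tendsto_intros tendsto_ennrealI) auto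
    then show "ennreal (exp (q 1 x / \<rho>)) = liminf (\<lambda>n. ennreal (exp (T n (q 1 x) / \<rho>)))"
      by (intro lim_imp_Liminf[symmetric]) simp_all
  qed
  also have "\<dots> \<le> liminf (\<lambda>n. \<integral>\<^sup>+x. ennreal (exp (T n (q 1 x) / \<rho>)) \<partial>k)"
    by (rule nn_integral_liminf) simp
  also have "\<dots> \<le> liminf (\<lambda>n. ennreal (exp ((\<integral>x. T n (q 0 x) \<partial>k) / \<rho>)))"
    using step by (intro Liminf_mono always_eventually allI)
  also have "\<dots> = ennreal (exp ((\<integral>x. q 0 x \<partial>k) / \<rho>))"
    using lim by (simp add: lim_imp_Liminf)
  finally show ?thesis .
qed

section \<open>Moments of log-Sobolev measures\<close>

text \<open>Herbst's argument, in the form of the subsolutions \<open>\<plusminus>f - t l\<^sup>2/2\<close>; the bound depends on the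
Lipschitz constant of \<open>f\<close> but not on its supremum.  The exponential moments at the single scale
\<open>1/\<rho>\<close> control the mean absolute deviation through \<open>|u| \<le> e\<^sup>u + e\<^bsup>-u\<^esup>\<close>.\<close>

lemma log_sobolev_concentration_bounded:
  fixes k :: "'a::euclidean_space measure"
  assumes k: "prob_space k" "sets k = sets borel" "log_sobolev \<rho> k" "0 < \<rho>"
    and f: "\<And>x. GDERIV f x :> D x" "\<And>x. norm (D x) \<le> l" "\<And>x. \<bar>f x\<bar> \<le> B"
  shows "(\<integral>x. \<bar>f x - (\<integral>y. f y \<partial>k)\<bar> \<partial>k) \<le> 2 * \<rho> * exp (l\<^sup>2 / (2 * \<rho>))"
proof -
  interpret prob_space k by fact
  note [measurable_cong] = k(2)
  have [measurable]: "f \<in> borel_measurable borel"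
    using f(1) by (rule measurable_if_GDERIV)
  define c where "c = (\<integral>y. f y \<partial>k)"
  have f_int: "integrable k f"
    by (rule integrable_const_bound[of _ B]) (use f(3) in auto)
  have exp_int: "integrable k (\<lambda>x. exp (s * (f x - c) / \<rho>))" if s: "\<bar>s\<bar> = 1" for s :: real
  proof (rule integrable_const_bound[of _ "exp ((B + \<bar>c\<bar>) / \<rho>)"])
    have "s * (f x - c) \<le> B + \<bar>c\<bar>" for x
    proof -
      have "s * (f x - c) \<le> \<bar>s * (f x - c)\<bar>"
        by (rule abs_ge_self)
      also have "\<dots> \<le> \<bar>f x\<bar> + \<bar>c\<bar>"
        using s by (simp add: abs_mult)
      finally show ?thesis
        using f(3)[of x] by linarith
    qed
    then show "AE x in k. norm (exp (s * (f x - c) / \<rho>)) \<le> exp ((B + \<bar>c\<bar>) / \<rho>)"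
      using k(4) by (intro AE_I2) (simp add: divide_right_mono)
  qed simp
  have main: "(\<integral>x. exp (s * (f x - c) / \<rho>) \<partial>k) \<le> exp (l\<^sup>2 / (2 * \<rho>))" if s: "\<bar>s\<bar> = 1" for s :: real
  proof -
    have "(\<integral>x. exp ((s * f x - 1 * (l\<^sup>2 / 2)) / \<rho>) \<partial>k) \<le> exp ((\<integral>x. s * f x - 0 * (l\<^sup>2 / 2) \<partial>k) / \<rho>)"
    proof (rule log_sobolev_Hamilton_Jacobi_bounded[OF k, where q = "\<lambda>t x. s * f x - t * (l\<^sup>2 / 2)"
          and q' = "\<lambda>t x. - (l\<^sup>2 / 2)" and Dq = "\<lambda>t x. s *\<^sub>R D x" and W = "\<lambda>_. l\<^sup>2 / 2"
          and B = "B + l\<^sup>2 / 2"])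
      fix t x assume t: "t \<in> {0..1::real}"
      show "GDERIV (\<lambda>x. s * f x - t * (l\<^sup>2 / 2)) x :> s *\<^sub>R D x"
        using GDERIV_diff[OF GDERIV_mult[OF GDERIV_const[of s x] f(1)[of x]] GDERIV_const] by simp
      show "((\<lambda>t. s * f x - t * (l\<^sup>2 / 2)) has_real_derivative - (l\<^sup>2 / 2)) (at t within {0..1})"
        by (auto intro!: derivative_eq_intros)
      show "- (l\<^sup>2 / 2) + (norm (s *\<^sub>R D x))\<^sup>2 / 2 \<le> 0"
        using power_mono[OF f(2)[of x] norm_ge_zero, of 2] s by simp
      have "t * (l\<^sup>2 / 2) \<le> 1 * (l\<^sup>2 / 2)"
        using t by (intro mult_right_mono) auto
      moreover have "0 \<le> t * (l\<^sup>2 / 2)"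
        using t by simp
      moreover have "\<bar>s * f x\<bar> \<le> B"
        using s f(3)[of x] by (simp add: abs_mult)
      ultimately show "\<bar>s * f x - t * (l\<^sup>2 / 2)\<bar> \<le> B + l\<^sup>2 / 2"
        by linarith
    qed auto
    also have "(\<integral>x. exp ((s * f x - 1 * (l\<^sup>2 / 2)) / \<rho>) \<partial>k)
        = (\<integral>x. exp (s * (f x - c) / \<rho>) * exp ((s * c - l\<^sup>2 / 2) / \<rho>) \<partial>k)"
      by (intro Bochner_Integration.integral_cong) (auto simp: exp_add[symmetric] add_divide_distrib[symmetric] algebra_simps)
    also have "\<dots> = (\<integral>x. exp (s * (f x - c) / \<rho>) \<partial>k) * exp ((s * c - l\<^sup>2 / 2) / \<rho>)"
      by simp
    finally have "(\<integral>x. exp (s * (f x - c) / \<rho>) \<partial>k) * exp ((s * c - l\<^sup>2 / 2) / \<rho>) \<le> exp (s * c / \<rho>)"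
      by (simp add: c_def)
    then have "(\<integral>x. exp (s * (f x - c) / \<rho>) \<partial>k) \<le> exp (s * c / \<rho>) / exp ((s * c - l\<^sup>2 / 2) / \<rho>)"
      by (simp add: pos_le_divide_eq)
    also have "\<dots> = exp (l\<^sup>2 / (2 * \<rho>))"
      using k(4) by (simp add: exp_diff[symmetric] diff_divide_distrib)
    finally show ?thesis .
  qed
  have "(\<integral>x. \<bar>f x - c\<bar> \<partial>k) \<le> (\<integral>x. \<rho> * (exp (1 * (f x - c) / \<rho>) + exp (-1 * (f x - c) / \<rho>)) \<partial>k)"
  proof (rule integral_mono)
    show "integrable k (\<lambda>x. \<bar>f x - c\<bar>)"
      using f_int by simp
    show "integrable k (\<lambda>x. \<rho> * (exp (1 * (f x - c) / \<rho>) + exp (-1 * (f x - c) / \<rho>)))"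
      using exp_int[of 1] exp_int[of "-1"] by simp
    fix x
    have "\<bar>u\<bar> \<le> exp u + exp (- u)" for u :: real
      using exp_ge_add_one_self[of u] exp_ge_add_one_self[of "- u"] exp_gt_zero[of u] exp_gt_zero[of "- u"]
      by linarith
    from this[of "(f x - c) / \<rho>"]
    show "\<bar>f x - c\<bar> \<le> \<rho> * (exp (1 * (f x - c) / \<rho>) + exp (-1 * (f x - c) / \<rho>))"
      using k(4) by (simp add: abs_div pos_divide_le_eq mult.commute minus_divide_left)
  qed
  also have "\<dots> = \<rho> * ((\<integral>x. exp (1 * (f x - c) / \<rho>) \<partial>k) + (\<integral>x. exp (-1 * (f x - c) / \<rho>) \<partial>k))"
    using exp_int[of 1] exp_int[of "-1"] by simp
  also have "\<dots> \<le> \<rho> * (exp (l\<^sup>2 / (2 * \<rho>)) + exp (l\<^sup>2 / (2 * \<rho>)))"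
    using main[of 1] main[of "-1"] k(4) by (intro mult_left_mono add_mono) auto
  finally show ?thesis
    by (simp add: c_def)
qed

text \<open>Concentration of the truncations \<open>T n\<close> of \<open>x \<bullet> v\<close> is uniform in \<open>n\<close>, but their means might
diverge.  Comparing two independent copies removes the means: Fatou's lemma then gives that
\<open>x \<bullet> v - y \<bullet> v\<close> is integrable for the product measure, hence in \<open>y\<close> for some fixed \<open>x\<close>.\<close>

lemma log_sobolev_integrable_inner:
  fixes k :: "'a::euclidean_space measure"
  assumes k: "prob_space k" "sets k = sets borel" "log_sobolev \<rho> k" "0 < \<rho>"
  shows "integrable k (\<lambda>x. x \<bullet> v)"
proof -
  interpret prob_space k by fact
  note [measurable_cong] = k(2)
  define C where "C = 2 * \<rho> * exp ((norm v)\<^sup>2 / (2 * \<rho>))"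
  have C: "0 \<le> C"
    using k(4) by (simp add: C_def)
  define T where "T n x = soft_truncation (real (Suc n)) (x \<bullet> v)" for n x
  have [measurable]: "T n \<in> borel_measurable borel" for n
    unfolding T_def by measurable
  have T_lim: "(\<lambda>n. T n x) \<longlonglongrightarrow> x \<bullet> v" for x
    unfolding T_def by (rule tendsto_soft_truncation)
  have T_int: "integrable k (T n)" for n
  proof (rule integrable_const_bound[of _ "real (Suc n) * (pi / 2)"])
    show "AE x in k. norm (T n x) \<le> real (Suc n) * (pi / 2)"
      unfolding T_def real_norm_def by (intro AE_I2 abs_soft_truncation_le) simp
  qed simp
  define c where "c n = (\<integral>x. T n x \<partial>k)" for n
  have conc: "(\<integral>\<^sup>+x. ennreal \<bar>T n x - c n\<bar> \<partial>k) \<le> ennreal C" for n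
  proof -
    have "(\<integral>\<^sup>+x. ennreal \<bar>T n x - c n\<bar> \<partial>k) = ennreal (\<integral>x. \<bar>T n x - c n\<bar> \<partial>k)"
      using T_int by (intro nn_integral_eq_integral) auto
    also have "\<dots> \<le> ennreal C"
      unfolding c_def C_def
    proof (intro ennreal_leI log_sobolev_concentration_bounded[OF k, where
          D = "\<lambda>x. inverse (1 + ((x \<bullet> v) / real (Suc n))\<^sup>2) *\<^sub>R v" and B = "real (Suc n) * (pi / 2)"])
      fix x
      have "GDERIV (\<lambda>x. x \<bullet> v) x :> v"
        unfolding gderiv_def by (auto intro!: derivative_eq_intros)
      from GDERIV_DERIV_compose[OF this soft_truncation_deriv]
      show "GDERIV (T n) x :> inverse (1 + ((x \<bullet> v) / real (Suc n))\<^sup>2) *\<^sub>R v"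
        unfolding T_def[abs_def] by simp
      show "norm (inverse (1 + ((x \<bullet> v) / real (Suc n))\<^sup>2) *\<^sub>R v) \<le> norm v"
        using inverse_one_plus_square[of "(x \<bullet> v) / real (Suc n)"]
        by (simp only: norm_scaleR real_norm_def abs_of_pos mult_left_le_one_le norm_ge_zero less_imp_le)
      show "\<bar>T n x\<bar> \<le> real (Suc n) * (pi / 2)"
        unfolding T_def by (rule abs_soft_truncation_le) simp
    qed
    finally show ?thesis .
  qed
  have double: "(\<integral>\<^sup>+x. \<integral>\<^sup>+y. ennreal \<bar>T n x - T n y\<bar> \<partial>k \<partial>k) \<le> ennreal C + ennreal C" for n
  proof -
    have "(\<integral>\<^sup>+x. \<integral>\<^sup>+y. ennreal \<bar>T n x - T n y\<bar> \<partial>k \<partial>k)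
        \<le> (\<integral>\<^sup>+x. \<integral>\<^sup>+y. ennreal \<bar>T n x - c n\<bar> + ennreal \<bar>T n y - c n\<bar> \<partial>k \<partial>k)"
      by (intro nn_integral_mono) (auto simp: ennreal_plus[symmetric] simp del: ennreal_plus intro!: ennreal_leI)
    also have "\<dots> = (\<integral>\<^sup>+x. ennreal \<bar>T n x - c n\<bar> \<partial>k) + (\<integral>\<^sup>+y. ennreal \<bar>T n y - c n\<bar> \<partial>k)"
      by (simp add: nn_integral_add emeasure_space_1)
    also have "\<dots> \<le> ennreal C + ennreal C"
      using conc by (intro add_mono)
    finally show ?thesis .
  qed
  have lim2: "ennreal \<bar>x \<bullet> v - y \<bullet> v\<bar> = liminf (\<lambda>n. ennreal \<bar>T n x - T n y\<bar>)" for x y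
    by (intro lim_imp_Liminf[symmetric] tendsto_ennrealI tendsto_rabs tendsto_diff T_lim) simp
  have inner: "(\<integral>\<^sup>+y. ennreal \<bar>x \<bullet> v - y \<bullet> v\<bar> \<partial>k) \<le> liminf (\<lambda>n. \<integral>\<^sup>+y. ennreal \<bar>T n x - T n y\<bar> \<partial>k)" for x
    unfolding lim2 by (rule nn_integral_liminf) simp
  have "(\<integral>\<^sup>+x. \<integral>\<^sup>+y. ennreal \<bar>x \<bullet> v - y \<bullet> v\<bar> \<partial>k \<partial>k)
      \<le> (\<integral>\<^sup>+x. liminf (\<lambda>n. \<integral>\<^sup>+y. ennreal \<bar>T n x - T n y\<bar> \<partial>k) \<partial>k)"
    using inner by (intro nn_integral_mono)
  also have "\<dots> \<le> liminf (\<lambda>n. \<integral>\<^sup>+x. \<integral>\<^sup>+y. ennreal \<bar>T n x - T n y\<bar> \<partial>k \<partial>k)"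
    by (rule nn_integral_liminf) measurable
  also have "\<dots> \<le> liminf (\<lambda>n. ennreal C + ennreal C)"
    using double by (intro Liminf_mono always_eventually allI)
  also have "\<dots> < \<infinity>"
    by (simp add: Liminf_const)
  finally have fin: "(\<integral>\<^sup>+x. \<integral>\<^sup>+y. ennreal \<bar>x \<bullet> v - y \<bullet> v\<bar> \<partial>k \<partial>k) < \<infinity>" .
  have "AE x in k. (\<integral>\<^sup>+y. ennreal \<bar>x \<bullet> v - y \<bullet> v\<bar> \<partial>k) \<noteq> \<infinity>"
    by (rule nn_integral_PInf_AE) (use fin in \<open>auto simp: less_top\<close>)
  then obtain x where x: "(\<integral>\<^sup>+y. ennreal \<bar>x \<bullet> v - y \<bullet> v\<bar> \<partial>k) \<noteq> \<infinity>"
    by (meson AE_False eventually_elim2 not_AE_zero_E)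
  have "integrable k (\<lambda>y. x \<bullet> v - y \<bullet> v)"
    unfolding integrable_iff_bounded using x by (auto simp: less_top[symmetric])
  then have "integrable k (\<lambda>y. x \<bullet> v - (x \<bullet> v - y \<bullet> v))"
    by (rule Bochner_Integration.integrable_diff[rotated]) simp
  then show ?thesis
    unfolding diff_diff_eq2 add_diff_cancel_left' .
qed

lemma log_sobolev_integrable_id:
  fixes k :: "'a::euclidean_space measure"
  assumes k: "prob_space k" "sets k = sets borel" "log_sobolev \<rho> k" "0 < \<rho>"
  shows "integrable k (\<lambda>x. x)"
proof (rule Bochner_Integration.integrable_bound)
  note [measurable_cong] = k(2)
  show "integrable k (\<lambda>x. \<Sum>b\<in>Basis. \<bar>x \<bullet> b\<bar>)"
    using log_sobolev_integrable_inner[OF k] by auto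
  show "(\<lambda>x. x) \<in> borel_measurable k"
    by measurable
  show "AE x in k. norm x \<le> norm (\<Sum>b\<in>Basis. \<bar>x \<bullet> b\<bar>)"
    by (rule AE_I2) (use norm_le_l1 in \<open>auto simp: sum_nonneg\<close>)
qed

text \<open>The subsolution \<open>q\<^sub>t(x) = (x - m) \<bullet> v - t |v|\<^sup>2/2\<close>, where \<open>m\<close> is the mean, so that \<open>\<integral> q\<^sub>0 = 0\<close>.\<close>

lemma log_sobolev_exp_linear:
  fixes k :: "'a::euclidean_space measure"
  assumes k: "prob_space k" "sets k = sets borel" "log_sobolev \<rho> k" "0 < \<rho>"
  shows "(\<integral>\<^sup>+x. ennreal (exp (((x - (\<integral>x. x \<partial>k)) \<bullet> v - (norm v)\<^sup>2 / 2) / \<rho>)) \<partial>k) \<le> 1"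
proof -
  interpret prob_space k by fact
  define m where "m = (\<integral>x. x \<partial>k)"
  note int = log_sobolev_integrable_id[OF k]
  have "(\<integral>\<^sup>+x. ennreal (exp (((x - m) \<bullet> v - 1 * ((norm v)\<^sup>2 / 2)) / \<rho>)) \<partial>k)
      \<le> ennreal (exp ((\<integral>x. (x - m) \<bullet> v - 0 * ((norm v)\<^sup>2 / 2) \<partial>k) / \<rho>))"
  proof (rule log_sobolev_Hamilton_Jacobi[OF k, where q = "\<lambda>t x. (x - m) \<bullet> v - t * ((norm v)\<^sup>2 / 2)"
        and q' = "\<lambda>t x. - ((norm v)\<^sup>2 / 2)" and Dq = "\<lambda>t x. v" and W = "\<lambda>_. (norm v)\<^sup>2 / 2"])
    fix t x
    show "GDERIV (\<lambda>x. (x - m) \<bullet> v - t * ((norm v)\<^sup>2 / 2)) x :> v"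
      unfolding gderiv_def by (auto intro!: derivative_eq_intros)
    show "((\<lambda>t. (x - m) \<bullet> v - t * ((norm v)\<^sup>2 / 2)) has_real_derivative - ((norm v)\<^sup>2 / 2)) (at t within {0..1})"
      by (auto intro!: derivative_eq_intros)
  qed (use int in auto)
  also have "(\<integral>x. (x - m) \<bullet> v - 0 * ((norm v)\<^sup>2 / 2) \<partial>k) = 0"
    using int by (simp add: m_def prob_space)
  finally show ?thesis
    by (simp add: m_def)
qed

text \<open>Sub-Gaussian moments in the directions \<open>\<plusminus>b\<close> for each basis vector \<open>b\<close>, and
\<open>w\<^sup>2 \<le> 2 (e\<^sup>w + e\<^bsup>-w\<^esup>)\<close>.  The constant is crude; what matters is that it depends only on \<open>\<rho>\<close> and
the dimension, so that averages of the trace of the covariance over a family of such laws are finite.\<close>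

lemma log_sobolev_second_moment:
  fixes k :: "'a::euclidean_space measure"
  assumes k: "prob_space k" "sets k = sets borel" "log_sobolev \<rho> k" "0 < \<rho>"
  shows "(\<integral>\<^sup>+x. ennreal ((norm (x - (\<integral>x. x \<partial>k)))\<^sup>2) \<partial>k) \<le> ennreal (real DIM('a) * (4 * exp (\<rho> / 2)))"
proof -
  note [measurable_cong] = k(2)
  define z where "z x = x - (\<integral>x. x \<partial>k)" for x
  have [measurable]: "z \<in> borel_measurable borel"
    unfolding z_def[abs_def] by measurable
  have exp_le: "(\<integral>\<^sup>+x. ennreal (exp (z x \<bullet> u)) \<partial>k) \<le> ennreal (exp (\<rho> / 2))" if u: "norm u = 1" for u
  proof -
    have "(\<integral>\<^sup>+x. ennreal (exp (z x \<bullet> u)) \<partial>k)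
        = (\<integral>\<^sup>+x. ennreal (exp (\<rho> / 2)) * ennreal (exp ((z x \<bullet> (\<rho> *\<^sub>R u) - (norm (\<rho> *\<^sub>R u))\<^sup>2 / 2) / \<rho>)) \<partial>k)"
    proof (rule nn_integral_cong)
      fix x
      have "z x \<bullet> u = \<rho> / 2 + (z x \<bullet> (\<rho> *\<^sub>R u) - (norm (\<rho> *\<^sub>R u))\<^sup>2 / 2) / \<rho>"
        using k(4) u by (simp add: field_simps power2_eq_square)
      then show "ennreal (exp (z x \<bullet> u))
          = ennreal (exp (\<rho> / 2)) * ennreal (exp ((z x \<bullet> (\<rho> *\<^sub>R u) - (norm (\<rho> *\<^sub>R u))\<^sup>2 / 2) / \<rho>))"
        by (simp only: exp_add ennreal_mult exp_ge_zero)
    qed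
    also have "\<dots> = ennreal (exp (\<rho> / 2))
        * (\<integral>\<^sup>+x. ennreal (exp ((z x \<bullet> (\<rho> *\<^sub>R u) - (norm (\<rho> *\<^sub>R u))\<^sup>2 / 2) / \<rho>)) \<partial>k)"
      by (intro nn_integral_cmult) simp
    also have "\<dots> \<le> ennreal (exp (\<rho> / 2)) * 1"
      using log_sobolev_exp_linear[OF k, of "\<rho> *\<^sub>R u"] by (intro mult_left_mono) (auto simp: z_def)
    finally show ?thesis by simp
  qed
  have square_le: "(\<integral>\<^sup>+x. ennreal ((z x \<bullet> b)\<^sup>2) \<partial>k) \<le> ennreal (4 * exp (\<rho> / 2))" if b: "b \<in> Basis" for b
  proof -
    have sq: "w\<^sup>2 \<le> 2 * exp w + 2 * exp (- w)" for w :: real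
    proof -
      have "w\<^sup>2 \<le> 2 * exp \<bar>w\<bar>"
        using exp_lower_Taylor_quadratic[of "\<bar>w\<bar>"] by simp
      then show ?thesis
        by (cases "0 \<le> w") (auto intro: order_trans add_increasing add_increasing2)
    qed
    have "(\<integral>\<^sup>+x. ennreal ((z x \<bullet> b)\<^sup>2) \<partial>k)
        \<le> (\<integral>\<^sup>+x. 2 * ennreal (exp (z x \<bullet> b)) + 2 * ennreal (exp (z x \<bullet> - b)) \<partial>k)"
    proof (rule nn_integral_mono)
      fix x
      have "ennreal ((z x \<bullet> b)\<^sup>2) \<le> ennreal (2 * exp (z x \<bullet> b) + 2 * exp (z x \<bullet> - b))"
        using sq[of "z x \<bullet> b"] by (intro ennreal_leI) simp
      then show "ennreal ((z x \<bullet> b)\<^sup>2) \<le> 2 * ennreal (exp (z x \<bullet> b)) + 2 * ennreal (exp (z x \<bullet> - b))"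
        by (simp add: ennreal_mult)
    qed
    also have "\<dots> = 2 * (\<integral>\<^sup>+x. ennreal (exp (z x \<bullet> b)) \<partial>k) + 2 * (\<integral>\<^sup>+x. ennreal (exp (z x \<bullet> - b)) \<partial>k)"
      by (simp add: nn_integral_add nn_integral_cmult)
    also have "\<dots> \<le> 2 * ennreal (exp (\<rho> / 2)) + 2 * ennreal (exp (\<rho> / 2))"
      using exp_le[of b] exp_le[of "- b"] b by (intro add_mono mult_left_mono) auto
    also have "\<dots> = ennreal (2 * exp (\<rho> / 2) + 2 * exp (\<rho> / 2))"
      by (simp add: ennreal_mult distrib_right[symmetric])
    finally show ?thesis by simp
  qed
  have norm_sq: "(norm w)\<^sup>2 = (\<Sum>b\<in>Basis. (w \<bullet> b)\<^sup>2)" for w :: 'a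
    unfolding power2_norm_eq_inner by (subst euclidean_inner) (simp add: power2_eq_square)
  have "(\<integral>\<^sup>+x. ennreal ((norm (z x))\<^sup>2) \<partial>k) = (\<integral>\<^sup>+x. (\<Sum>b\<in>Basis. ennreal ((z x \<bullet> b)\<^sup>2)) \<partial>k)"
    by (simp add: norm_sq sum_ennreal)
  also have "\<dots> = (\<Sum>b\<in>Basis. \<integral>\<^sup>+x. ennreal ((z x \<bullet> b)\<^sup>2) \<partial>k)"
    by (intro nn_integral_sum) simp
  also have "\<dots> \<le> (\<Sum>b\<in>(Basis::'a set). ennreal (4 * exp (\<rho> / 2)))"
    using square_le by (intro sum_mono)
  also have "\<dots> = ennreal (real DIM('a) * (4 * exp (\<rho> / 2)))"
    by (subst sum_ennreal) auto
  finally show ?thesis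
    by (simp add: z_def)
qed

section \<open>Quadratic functions and covariance matrices\<close>

definition outer :: "real^'d \<Rightarrow> real^'d^'d" where
  "outer z = (\<chi> i j. z $ i * z $ j)"

lemma inner_outer: "A \<bullet> outer z = z \<bullet> (A *v z)"
  by (simp add: outer_def inner_vec_def matrix_vector_mult_def sum_distrib_left algebra_simps)

lemma norm_outer: "norm (outer z) = (norm z)\<^sup>2"
proof -
  have "outer z *v z = (z \<bullet> z) *\<^sub>R z"
    by (simp add: outer_def vec_eq_iff matrix_vector_mult_def inner_vec_def sum_distrib_left sum_distrib_right algebra_simps)
  \<comment> \<open>Take the inner product of \<open>outer z\<close> with itself in \<open>inner_outer\<close>.\<close>
  then have "(norm (outer z))\<^sup>2 = ((norm z)\<^sup>2)\<^sup>2"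
    unfolding power2_norm_eq_inner inner_outer by (simp add: power2_eq_square[of "_ \<bullet> _"])
  then show ?thesis
    by (simp only: power2_eq_iff_nonneg norm_ge_zero zero_le_power2)
qed

lemma outer_measurable[measurable]: "outer \<in> borel_measurable borel"
  unfolding outer_def[abs_def]
  by (intro borel_measurable_continuous_onI continuous_intros)

lemma frobenius_norm_eq_norm: "frobenius_norm A = norm A"
proof -
  have "trace (transpose A ** A) = A \<bullet> A"
    unfolding trace_def inner_vec_def matrix_matrix_mult_def transpose_def
    by (subst sum.swap) simp
  then show ?thesis
    by (simp add: frobenius_norm_def norm_eq_sqrt_inner)
qed

lemma norm_matrix_vector_mult_le: "norm (A *v z) \<le> norm A * norm z" for A :: "real^'d^'d"
proof -
  have "(norm (A *v z))\<^sup>2 = (\<Sum>i\<in>UNIV. (A $ i \<bullet> z)\<^sup>2)"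
    unfolding power2_norm_eq_inner inner_vec_def[of "A *v z"]
    by (simp add: matrix_vector_mul_component power2_eq_square)
  also have "\<dots> \<le> (\<Sum>i\<in>UNIV. (norm (A $ i))\<^sup>2 * (norm z)\<^sup>2)"
    by (intro sum_mono) (metis Cauchy_Schwarz_ineq power2_norm_eq_inner)
  also have "\<dots> = (norm A * norm z)\<^sup>2"
    by (simp add: power_mult_distrib power2_norm_eq_inner[of A] inner_vec_def[of A] sum_distrib_right
        power2_norm_eq_inner[of "A $ _"])
  finally show ?thesis
    by (rule power2_le_imp_le) simp
qed

lemma trace_eq_inner: "trace A = mat 1 \<bullet> A" for A :: "real^'d^'d"
  by (simp add: trace_def mat_def inner_vec_def if_distrib[of "\<lambda>c. c * _"] sum.delta cong: if_cong)

lemma log_sobolev_integrable_norm_square: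
  fixes k :: "'a::euclidean_space measure"
  assumes k: "prob_space k" "sets k = sets borel" "log_sobolev \<rho> k" "0 < \<rho>"
  shows "integrable k (\<lambda>x. (norm (x - c))\<^sup>2)"
proof -
  interpret prob_space k by fact
  note [measurable_cong] = k(2)
  define m where "m = (\<integral>x. x \<partial>k)"
  have "integrable k (\<lambda>x. (norm (x - m))\<^sup>2)"
    unfolding integrable_iff_bounded using log_sobolev_second_moment[OF k]
    by (auto simp: m_def intro: le_less_trans)
  then have *: "integrable k (\<lambda>x. 2 * (norm (x - m))\<^sup>2 + 2 * (norm (m - c))\<^sup>2)"
    by simp
  show ?thesis
  proof (rule Bochner_Integration.integrable_bound[OF *])
    show "AE x in k. norm ((norm (x - c))\<^sup>2) \<le> norm (2 * (norm (x - m))\<^sup>2 + 2 * (norm (m - c))\<^sup>2)"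
    proof (rule AE_I2)
      fix x
      have "norm (x - c) \<le> norm (x - m) + norm (m - c)"
        using norm_triangle_ineq[of "x - m" "m - c"] by simp
      then have "(norm (x - c))\<^sup>2 \<le> (norm (x - m) + norm (m - c))\<^sup>2"
        by (rule power_mono) simp
      also have "\<dots> \<le> 2 * (norm (x - m))\<^sup>2 + 2 * (norm (m - c))\<^sup>2"
        using sum_squares_bound[of "norm (x - m)" "norm (m - c)"] by (simp add: power2_sum)
      finally show "norm ((norm (x - c))\<^sup>2) \<le> norm (2 * (norm (x - m))\<^sup>2 + 2 * (norm (m - c))\<^sup>2)"
        by simp
    qed
  qed measurable
qed

lemma log_sobolev_integrable_quadratic:
  fixes k :: "(real^'d) measure" and A :: "real^'d^'d"
  assumes k: "prob_space k" "sets k = sets borel" "log_sobolev \<rho> k" "0 < \<rho>"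
  shows "integrable k (\<lambda>x. outer (x - c))" "integrable k (\<lambda>x. (x - c) \<bullet> (A *v (x - c)))"
proof -
  note [measurable_cong] = k(2)
  show *: "integrable k (\<lambda>x. outer (x - c))"
    by (rule Bochner_Integration.integrable_bound[OF log_sobolev_integrable_norm_square[OF k, of c]])
      (auto simp: norm_outer)
  show "integrable k (\<lambda>x. (x - c) \<bullet> (A *v (x - c)))"
    unfolding inner_outer[symmetric] using * by simp
qed

text \<open>The quadratic subsolution with \<open>\<kappa>\<^sub>t = s/(1 - s t) - s\<close>, the solution of \<open>\<kappa>' = (s + \<kappa>)\<^sup>2\<close> with
\<open>\<kappa>\<^sub>0 = 0\<close>; at time \<open>1\<close> it equals \<open>s\<^sup>2/(1 - s)\<close>.  The exact solution would have the matrix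
\<open>s A (I + s A)\<^bsup>-1\<^esup>\<close>; replacing the correction to \<open>s A\<close> by a multiple of the identity avoids matrix
inverses and leaves only the trace of the covariance as an error term.\<close>

theorem log_sobolev_exp_quadratic:
  fixes k :: "(real^'d) measure" and A :: "real^'d^'d"
  assumes k: "prob_space k" "sets k = sets borel" "log_sobolev \<rho> k" "0 < \<rho>"
    and A: "transpose A = A" "norm A \<le> 1" and s: "0 < s" "s < 1"
  shows "(\<integral>\<^sup>+x. ennreal (exp (((s / 2) * ((x - c) \<bullet> (A *v (x - c)))
            - (s\<^sup>2 / (1 - s)) / 2 * (norm (x - c))\<^sup>2) / \<rho>)) \<partial>k)
    \<le> ennreal (exp ((\<integral>x. (s / 2) * ((x - c) \<bullet> (A *v (x - c))) \<partial>k) / \<rho>))"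
proof -
  define \<kappa> where "\<kappa> t = s / (1 - s * t) - s" for t
  have st: "0 < 1 - s * t" "1 - s \<le> 1 - s * t" if "t \<in> {0..1}" for t
  proof -
    have "s * t \<le> s * 1"
      using that s by (intro mult_left_mono) auto
    then show "0 < 1 - s * t" "1 - s \<le> 1 - s * t"
      using s by linarith+
  qed
  have "(\<integral>\<^sup>+x. ennreal (exp (((s / 2) * ((x - c) \<bullet> (A *v (x - c))) - \<kappa> 1 / 2 * (norm (x - c))\<^sup>2) / \<rho>)) \<partial>k)
    \<le> ennreal (exp ((\<integral>x. (s / 2) * ((x - c) \<bullet> (A *v (x - c))) - \<kappa> 0 / 2 * (norm (x - c))\<^sup>2 \<partial>k) / \<rho>))"
  proof (rule log_sobolev_Hamilton_Jacobi[OF k, where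
        q = "\<lambda>t x. (s / 2) * ((x - c) \<bullet> (A *v (x - c))) - \<kappa> t / 2 * (norm (x - c))\<^sup>2" and
        q' = "\<lambda>t x. - (s / (1 - s * t))\<^sup>2 / 2 * (norm (x - c))\<^sup>2" and
        Dq = "\<lambda>t x. s *\<^sub>R (A *v (x - c)) - \<kappa> t *\<^sub>R (x - c)" and
        W = "\<lambda>x. (s / (1 - s))\<^sup>2 / 2 * (norm (x - c))\<^sup>2"])
    fix t x assume t: "t \<in> {0..1::real}"
    have sym: "z \<bullet> (A *v h) = h \<bullet> (A *v z)" for z h
      by (metis A(1) dot_lmul_matrix inner_commute transpose_matrix_vector)
    have "((\<lambda>x. (x - c) \<bullet> (A *v (x - c))) has_derivative (\<lambda>h. (x - c) \<bullet> (A *v h) + h \<bullet> (A *v (x - c)))) (at x)"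
      by (intro has_derivative_inner bounded_linear.has_derivative[OF matrix_vector_mul_bounded_linear])
        (auto intro!: derivative_eq_intros)
    then have 1: "GDERIV (\<lambda>x. (x - c) \<bullet> (A *v (x - c))) x :> 2 *\<^sub>R (A *v (x - c))"
      unfolding gderiv_def sym[of "x - c"] by simp
    have 2: "GDERIV (\<lambda>x. (norm (x - c))\<^sup>2) x :> 2 *\<^sub>R (x - c)"
      unfolding gderiv_def power2_norm_eq_inner
      by (auto intro!: derivative_eq_intros simp: inner_commute)
    show "GDERIV (\<lambda>x. (s / 2) * ((x - c) \<bullet> (A *v (x - c))) - \<kappa> t / 2 * (norm (x - c))\<^sup>2) x
        :> s *\<^sub>R (A *v (x - c)) - \<kappa> t *\<^sub>R (x - c)"
      using GDERIV_diff[OF GDERIV_mult[OF GDERIV_const 1] GDERIV_mult[OF GDERIV_const 2], of "s / 2" "\<kappa> t / 2"]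
      by simp
    have "(\<kappa> has_real_derivative (s / (1 - s * t))\<^sup>2) (at t within {0..1})"
      unfolding \<kappa>_def[abs_def] using st[OF t]
      by (auto intro!: derivative_eq_intros simp: power2_eq_square)
    then show "((\<lambda>t. (s / 2) * ((x - c) \<bullet> (A *v (x - c))) - \<kappa> t / 2 * (norm (x - c))\<^sup>2)
        has_real_derivative - (s / (1 - s * t))\<^sup>2 / 2 * (norm (x - c))\<^sup>2) (at t within {0..1})"
      by (auto intro!: derivative_eq_intros)
    have "s * (1 - s * t) \<le> s * 1"
      using s t by (intro mult_left_mono) auto
    then have "s \<le> s / (1 - s * t)"
      unfolding pos_le_divide_eq[OF st(1)[OF t]] by simp
    then have \<kappa>: "0 \<le> \<kappa> t"
      by (simp add: \<kappa>_def)
    have "norm (s *\<^sub>R (A *v (x - c)) - \<kappa> t *\<^sub>R (x - c)) \<le> norm (s *\<^sub>R (A *v (x - c))) + norm (\<kappa> t *\<^sub>R (x - c))"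
      by (rule norm_triangle_ineq4)
    also have "\<dots> \<le> s * (1 * norm (x - c)) + \<kappa> t * norm (x - c)"
      using s \<kappa> A(2)
      by (auto intro!: mult_left_mono order_trans[OF norm_matrix_vector_mult_le] mult_left_le_one_le)
    also have "\<dots> = s / (1 - s * t) * norm (x - c)"
      by (simp add: \<kappa>_def algebra_simps)
    finally have "(norm (s *\<^sub>R (A *v (x - c)) - \<kappa> t *\<^sub>R (x - c)))\<^sup>2 \<le> (s / (1 - s * t) * norm (x - c))\<^sup>2"
      by (rule power_mono) simp
    then show "- (s / (1 - s * t))\<^sup>2 / 2 * (norm (x - c))\<^sup>2 + (norm (s *\<^sub>R (A *v (x - c)) - \<kappa> t *\<^sub>R (x - c)))\<^sup>2 / 2 \<le> 0"
      unfolding power_mult_distrib by linarith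
    have "s / (1 - s * t) \<le> s / (1 - s)"
      using st[OF t] s by (intro divide_left_mono mult_pos_pos) linarith+
    then have "(s / (1 - s * t))\<^sup>2 \<le> (s / (1 - s))\<^sup>2"
      using st[OF t] s by (intro power_mono divide_nonneg_pos) linarith+
    then show "\<bar>- (s / (1 - s * t))\<^sup>2 / 2 * (norm (x - c))\<^sup>2\<bar> \<le> (s / (1 - s))\<^sup>2 / 2 * (norm (x - c))\<^sup>2"
      by (auto simp: abs_mult intro!: mult_right_mono)
  next
    show "integrable k (\<lambda>x. (s / (1 - s))\<^sup>2 / 2 * (norm (x - c))\<^sup>2)"
      using log_sobolev_integrable_norm_square[OF k] by simp
    show "integrable k (\<lambda>x. (s / 2) * ((x - c) \<bullet> (A *v (x - c))) - \<kappa> 0 / 2 * (norm (x - c))\<^sup>2)"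
      using log_sobolev_integrable_norm_square[OF k] log_sobolev_integrable_quadratic(2)[OF k] by simp
  qed measurable
  moreover have "\<kappa> 1 = s\<^sup>2 / (1 - s)"
    using s by (simp add: \<kappa>_def field_simps power2_eq_square)
  moreover have "\<kappa> 0 = 0"
    by (simp add: \<kappa>_def)
  ultimately show ?thesis
    by simp
qed

lemma inner_kernel_cov:
  fixes K :: "'b \<Rightarrow> (real^'d) measure" and A :: "real^'d^'d"
  assumes k: "prob_space (K y)" "sets (K y) = sets borel" "log_sobolev \<rho> (K y)" "0 < \<rho>"
  shows "A \<bullet> kernel_cov K y = (\<integral>x. (x - kernel_mean K y) \<bullet> (A *v (x - kernel_mean K y)) \<partial>K y)"
proof -
  have "kernel_cov K y = (\<integral>x. outer (x - kernel_mean K y) \<partial>K y)"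
    by (simp add: kernel_cov_def outer_def)
  then show ?thesis
    using log_sobolev_integrable_quadratic(1)[OF k] by (simp add: inner_outer[symmetric])
qed

text \<open>The mixed terms of the expansion about the mean \<open>m\<close> are linear in \<open>x - m\<close> and integrate to \<open>0\<close>.\<close>

lemma inner_kernel_cov_shifted:
  fixes K :: "'b \<Rightarrow> (real^'d) measure" and A :: "real^'d^'d"
  assumes k: "prob_space (K y)" "sets (K y) = sets borel" "log_sobolev \<rho> (K y)" "0 < \<rho>"
  shows "(\<integral>x. (x - c) \<bullet> (A *v (x - c)) \<partial>K y)
    = A \<bullet> kernel_cov K y + (kernel_mean K y - c) \<bullet> (A *v (kernel_mean K y - c))"
proof -
  interpret prob_space "K y" by fact
  define m where "m = kernel_mean K y"
  note int = log_sobolev_integrable_id[OF k]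
  have z: "integrable (K y) (\<lambda>x. x - m)" "(\<integral>x. x - m \<partial>K y) = 0"
    using int by (simp_all add: m_def kernel_mean_def prob_space)
  have lin: "(x - m) \<bullet> (A *v (m - c)) + (m - c) \<bullet> (A *v (x - m))
      = (x - m) \<bullet> (A *v (m - c) + (m - c) v* A)" for x
    by (simp add: inner_add_right dot_lmul_matrix[symmetric] inner_commute)
  have "(\<integral>x. (x - c) \<bullet> (A *v (x - c)) \<partial>K y)
      = (\<integral>x. (x - m) \<bullet> (A *v (x - m)) + (x - m) \<bullet> (A *v (m - c) + (m - c) v* A)
          + (m - c) \<bullet> (A *v (m - c)) \<partial>K y)"
  proof (rule Bochner_Integration.integral_cong[OF refl])
    fix x
    have "x - c = (x - m) + (m - c)"
      by simp
    then show "(x - c) \<bullet> (A *v (x - c)) = (x - m) \<bullet> (A *v (x - m)) + (x - m) \<bullet> (A *v (m - c) + (m - c) v* A)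
          + (m - c) \<bullet> (A *v (m - c))"
      unfolding lin[symmetric]
      by (simp only: matrix_vector_right_distrib inner_add_left inner_add_right add.assoc)
  qed
  also have "\<dots> = (\<integral>x. (x - m) \<bullet> (A *v (x - m)) \<partial>K y) + (m - c) \<bullet> (A *v (m - c))"
    using z log_sobolev_integrable_quadratic(2)[OF k, of m A] by (simp add: prob_space del: inner_diff_left)
  finally show ?thesis
    by (simp add: inner_kernel_cov[where \<rho> = \<rho>] k m_def)
qed

lemma trace_kernel_cov:
  fixes K :: "'b \<Rightarrow> (real^'d) measure"
  assumes k: "prob_space (K y)" "sets (K y) = sets borel" "log_sobolev \<rho> (K y)" "0 < \<rho>"
  shows "trace (kernel_cov K y) = (\<integral>x. (norm (x - kernel_mean K y))\<^sup>2 \<partial>K y)"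
    and "0 \<le> trace (kernel_cov K y)"
    and "trace (kernel_cov K y) \<le> real CARD('d) * (4 * exp (\<rho> / 2))"
proof -
  show 1: "trace (kernel_cov K y) = (\<integral>x. (norm (x - kernel_mean K y))\<^sup>2 \<partial>K y)"
    unfolding trace_eq_inner inner_kernel_cov[where K = K and y = y and \<rho> = \<rho>, OF k] by (simp add: power2_norm_eq_inner)
  then show "0 \<le> trace (kernel_cov K y)"
    by (simp add: integral_nonneg)
  have "ennreal (\<integral>x. (norm (x - kernel_mean K y))\<^sup>2 \<partial>K y) = (\<integral>\<^sup>+x. ennreal ((norm (x - kernel_mean K y))\<^sup>2) \<partial>K y)"
    using log_sobolev_integrable_norm_square[OF k] by (intro nn_integral_eq_integral[symmetric]) auto
  also have "\<dots> \<le> ennreal (real CARD('d) * (4 * exp (\<rho> / 2)))"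
    using log_sobolev_second_moment[OF k] by (simp add: kernel_mean_def)
  finally show "trace (kernel_cov K y) \<le> real CARD('d) * (4 * exp (\<rho> / 2))"
    by (simp add: 1 ennreal_le_iff)
qed

lemma transpose_kernel_cov:
  fixes K :: "'b \<Rightarrow> (real^'d) measure"
  assumes k: "prob_space (K y)" "sets (K y) = sets borel" "log_sobolev \<rho> (K y)" "0 < \<rho>"
  shows "transpose (kernel_cov K y) = kernel_cov K y"
proof -
  have lin: "linear (transpose :: real^'d^'d \<Rightarrow> _)"
    by (auto intro!: linearI simp: transpose_def vec_eq_iff)
  have "transpose (kernel_cov K y) = transpose (\<integral>x. outer (x - kernel_mean K y) \<partial>K y)"
    by (simp add: kernel_cov_def outer_def)
  also have "\<dots> = (\<integral>x. transpose (outer (x - kernel_mean K y)) \<partial>K y)"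
    using log_sobolev_integrable_quadratic(1)[OF k] lin
    by (intro integral_bounded_linear[symmetric]) (simp_all add: linear_conv_bounded_linear)
  also have "\<dots> = kernel_cov K y"
    by (simp add: kernel_cov_def outer_def transpose_def mult.commute)
  finally show ?thesis .
qed

section \<open>Relative entropy between laws with a common second marginal\<close>

text \<open>With \<open>e\<close> the log-density of \<open>P\<close> with respect to \<open>Q\<close>, the inequality \<open>u + 1 \<le> e\<^sup>u\<close> at \<open>u = G - e\<close>
integrates to \<open>\<integral> G dP \<le> \<integral> e dP\<close>, since \<open>exp (G - e)\<close> has \<open>P\<close>-integral at most
\<open>\<integral> exp G dQ \<le> 1\<close>.\<close>

lemma Donsker_Varadhan:
  assumes P: "prob_space P" and Q: "prob_space Q" "sets P = sets Q"
    and G: "integrable P G"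
    and exp_le: "(\<integral>\<^sup>+x. ennreal (exp (G x)) \<partial>Q) \<le> 1"
  shows "ennreal (\<integral>x. G x \<partial>P) \<le> rel_entropy P Q"
proof (cases "absolutely_continuous Q P \<and> integrable P (entropy_density (exp 1) Q P)")
  case True
  interpret P: prob_space P by fact
  interpret Q: prob_space Q by fact
  note [measurable_cong] = Q(2)
  have [measurable]: "G \<in> borel_measurable Q"
    using borel_measurable_integrable[OF G] by simp
  define r where "r = RN_deriv Q P"
  have [measurable]: "r \<in> borel_measurable Q"
    by (simp add: r_def)
  have Pr: "P = density Q r"
    unfolding r_def using True Q(2) by (simp add: Q.density_RN_deriv)
  define e where "e x = ln (enn2real (r x))" for x
  have e: "entropy_density (exp 1) Q P = e"
    by (simp add: entropy_density_def e_def[abs_def] r_def o_def log_ln)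
  have e_int: "integrable P e"
    using True by (simp add: e)
  have [measurable]: "e \<in> borel_measurable Q"
    unfolding e_def[abs_def] by measurable
  have r_fin: "AE x in Q. r x \<noteq> \<infinity>"
    unfolding r_def using True Q(2) P.sigma_finite_measure_axioms by (intro Q.RN_deriv_finite) auto
  have "(\<integral>\<^sup>+x. ennreal (exp (G x - e x)) \<partial>P) = (\<integral>\<^sup>+x. r x * ennreal (exp (G x - e x)) \<partial>Q)"
    unfolding Pr by (rule nn_integral_density) simp_all
  also have "\<dots> \<le> (\<integral>\<^sup>+x. ennreal (exp (G x)) \<partial>Q)"
  proof (rule nn_integral_mono_AE)
    show "AE x in Q. r x * ennreal (exp (G x - e x)) \<le> ennreal (exp (G x))"
      using r_fin
    proof eventually_elim
      case (elim x)
      show ?case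
      proof (cases "r x" rule: ennreal_cases)
        case (real u)
        show ?thesis
        proof (cases "u = 0")
          case False
          then have "u * exp (G x - e x) = exp (G x)"
            using real by (simp add: e_def exp_diff)
          then show ?thesis
            using real by (simp add: ennreal_mult[symmetric])
        qed (use real in simp)
      qed (use elim in simp)
    qed
  qed
  also note exp_le
  finally have le1: "(\<integral>\<^sup>+x. ennreal (exp (G x - e x)) \<partial>P) \<le> 1" .
  have Ge_int: "integrable P (\<lambda>x. exp (G x - e x))"
    unfolding integrable_iff_bounded using le1 by (auto intro: le_less_trans)
  have "ennreal (\<integral>x. exp (G x - e x) \<partial>P) \<le> 1"
    using le1 nn_integral_eq_integral[OF Ge_int] by simp
  then have "(\<integral>x. exp (G x - e x) \<partial>P) \<le> 1"
    by simp
  moreover have "(\<integral>x. (G x - e x) + 1 \<partial>P) \<le> (\<integral>x. exp (G x - e x) \<partial>P)"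
    using G e_int Ge_int by (intro integral_mono) (auto simp: add.commute exp_ge_add_one_self)
  moreover have "(\<integral>x. (G x - e x) + 1 \<partial>P) = (\<integral>x. G x \<partial>P) - (\<integral>x. e x \<partial>P) + 1"
    using G e_int by (simp add: P.prob_space)
  ultimately have "(\<integral>x. G x \<partial>P) \<le> (\<integral>x. e x \<partial>P)"
    by simp
  also have "(\<integral>x. e x \<partial>P) = KL_divergence (exp 1) Q P"
    by (simp add: KL_divergence_def e)
  finally show ?thesis
    using True by (simp add: rel_entropy_def ennreal_leI)
qed (auto simp: rel_entropy_def)

lemma markov_kernelD:
  assumes "markov_kernel K"
  shows "K \<in> borel \<rightarrow>\<^sub>M subprob_algebra borel" "prob_space (K y)" "sets (K y) = sets borel"
proof -
  show "K \<in> borel \<rightarrow>\<^sub>M subprob_algebra borel"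
    using assms unfolding markov_kernel_def by (rule measurable_prob_algebraD)
  have "K y \<in> space (prob_algebra borel)"
    using assms unfolding markov_kernel_def by (auto intro: measurable_space)
  then show "prob_space (K y)" "sets (K y) = sets borel"
    by (auto simp: space_prob_algebra)
qed

lemma measurable_backward_kernel:
  fixes K :: "'a::topological_space \<Rightarrow> 'a measure"
  assumes "markov_kernel K"
  shows "(\<lambda>y. distr (K y) (borel \<Otimes>\<^sub>M borel) (\<lambda>x. (x, y))) \<in> borel \<rightarrow>\<^sub>M subprob_algebra (borel \<Otimes>\<^sub>M borel)"
  by (rule measurable_distr2[OF _ markov_kernelD(1)[OF assms]]) simp

text \<open>Measurability of \<open>y \<mapsto> \<integral> g(x,y) K(y,dx)\<close> reduces to a fixed integrand by pushing \<open>K y\<close> forward to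
the product space along \<open>x \<mapsto> (x,y)\<close>.\<close>

lemma measurable_kernel_integral:
  fixes g :: "'a::topological_space \<Rightarrow> 'a \<Rightarrow> 'b::{banach, second_countable_topology}"
  assumes K: "markov_kernel K"
    and g: "(\<lambda>(x, y). g x y) \<in> borel_measurable (borel \<Otimes>\<^sub>M borel)"
  shows "(\<lambda>y. \<integral>x. g x y \<partial>K y) \<in> borel_measurable borel"
proof -
  have "(\<integral>x. g x y \<partial>K y) = (\<integral>z. (\<lambda>(x, y). g x y) z \<partial>distr (K y) (borel \<Otimes>\<^sub>M borel) (\<lambda>x. (x, y)))" for y
    using g markov_kernelD(3)[OF K] by (subst integral_distr) (auto cong: measurable_cong_sets)
  then show ?thesis
    using measurable_compose[OF measurable_backward_kernel[OF K] integral_measurable_subprob_algebra[OF g]]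
    by simp
qed

context
  fixes \<eta> :: "'a::topological_space measure" and K :: "'a \<Rightarrow> 'a measure"
  assumes \<eta>: "prob_space \<eta>" "sets \<eta> = sets borel" and K: "markov_kernel K"
begin

lemma measurable_backward_kernel':
  "(\<lambda>y. distr (K y) (borel \<Otimes>\<^sub>M borel) (\<lambda>x. (x, y))) \<in> \<eta> \<rightarrow>\<^sub>M subprob_algebra (borel \<Otimes>\<^sub>M borel)"
  using measurable_backward_kernel[OF K] \<eta>(2) by (simp cong: measurable_cong_sets)

lemma sets_backward_prod: "sets (backward_prod \<eta> K) = sets (borel \<Otimes>\<^sub>M borel)"
  unfolding backward_prod_def using prob_space.not_empty[OF \<eta>(1)] by (intro sets_bind) auto

lemma prob_space_backward_prod: "prob_space (backward_prod \<eta> K)"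
proof -
  interpret prob_space \<eta> by (rule \<eta>)
  have "prob_space (distr (K y) (borel \<Otimes>\<^sub>M borel) (\<lambda>x. (x, y)))" for y
    using markov_kernelD(2,3)[OF K] by (intro prob_space.prob_space_distr) (auto cong: measurable_cong_sets)
  then show ?thesis
    unfolding backward_prod_def using measurable_backward_kernel' by (intro prob_space_bind) auto
qed

lemma nn_integral_backward_prod:
  assumes g: "(\<lambda>(x, y). g x y) \<in> borel_measurable (borel \<Otimes>\<^sub>M borel)"
  shows "(\<integral>\<^sup>+(x, y). g x y \<partial>backward_prod \<eta> K) = (\<integral>\<^sup>+y. \<integral>\<^sup>+x. g x y \<partial>K y \<partial>\<eta>)"
  unfolding backward_prod_def nn_integral_bind[OF g measurable_backward_kernel']
  using g markov_kernelD(3)[OF K]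
  by (intro nn_integral_cong, subst nn_integral_distr) (auto cong: measurable_cong_sets)

text \<open>The uniform bound \<open>C\<close> makes all integrals over \<open>y\<close> finite; the identity then follows from the one
for nonnegative functions, applied to the positive and the negative part of \<open>g\<close>.\<close>

lemma integral_backward_prod:
  fixes g :: "'a \<Rightarrow> 'a \<Rightarrow> real"
  assumes g: "(\<lambda>(x, y). g x y) \<in> borel_measurable (borel \<Otimes>\<^sub>M borel)"
    and int: "\<And>y. integrable (K y) (\<lambda>x. g x y)"
    and bnd: "\<And>y. (\<integral>x. \<bar>g x y\<bar> \<partial>K y) \<le> C"
  shows "integrable (backward_prod \<eta> K) (\<lambda>(x, y). g x y)"
    and "(\<integral>(x, y). g x y \<partial>backward_prod \<eta> K) = (\<integral>y. \<integral>x. g x y \<partial>K y \<partial>\<eta>)"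
proof -
  interpret prob_space \<eta> by (rule \<eta>)
  note [measurable_cong] = \<eta>(2) sets_backward_prod
  note g[measurable]
  have gm: "(\<lambda>(x, y). max 0 (g x y)) \<in> borel_measurable (borel \<Otimes>\<^sub>M borel)"
    "(\<lambda>(x, y). max 0 (- g x y)) \<in> borel_measurable (borel \<Otimes>\<^sub>M borel)"
    "(\<lambda>(x, y). \<bar>g x y\<bar>) \<in> borel_measurable (borel \<Otimes>\<^sub>M borel)"
    by measurable
  have part: "(\<integral>\<^sup>+(x, y). ennreal (f x y) \<partial>backward_prod \<eta> K) = ennreal (\<integral>y. \<integral>x. f x y \<partial>K y \<partial>\<eta>)
      \<and> integrable \<eta> (\<lambda>y. \<integral>x. f x y \<partial>K y)"
    if f: "(\<lambda>(x, y). f x y) \<in> borel_measurable (borel \<Otimes>\<^sub>M borel)"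
      and f_le: "\<And>x y. 0 \<le> f x y" "\<And>x y. f x y \<le> \<bar>g x y\<bar>" for f :: "'a \<Rightarrow> 'a \<Rightarrow> real"
  proof -
    have f_int: "integrable (K y) (\<lambda>x. f x y)" for y
    proof (rule Bochner_Integration.integrable_bound[OF int[of y]])
      show "(\<lambda>x. f x y) \<in> borel_measurable (K y)"
        using measurable_compose[OF measurable_Pair2'[of y borel borel] f] markov_kernelD(3)[OF K]
        by (simp cong: measurable_cong_sets)
    qed (use f_le in auto)
    have "integrable \<eta> (\<lambda>y. \<integral>x. f x y \<partial>K y)"
    proof (rule integrable_const_bound[of _ C])
      show "AE y in \<eta>. norm (\<integral>x. f x y \<partial>K y) \<le> C"
      proof (rule AE_I2)
        fix y
        have "norm (\<integral>x. f x y \<partial>K y) \<le> (\<integral>x. \<bar>g x y\<bar> \<partial>K y)"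
          using f_int[of y] int[of y] f_le by (auto simp: integral_nonneg intro!: integral_mono)
        then show "norm (\<integral>x. f x y \<partial>K y) \<le> C"
          using bnd[of y] by linarith
      qed
      show "(\<lambda>y. \<integral>x. f x y \<partial>K y) \<in> borel_measurable \<eta>"
        using measurable_kernel_integral[OF K f] by simp
    qed
    moreover have "(\<integral>\<^sup>+(x, y). ennreal (f x y) \<partial>backward_prod \<eta> K) = (\<integral>\<^sup>+y. \<integral>\<^sup>+x. ennreal (f x y) \<partial>K y \<partial>\<eta>)"
      by (rule nn_integral_backward_prod) (use f in measurable)
    moreover have "\<dots> = (\<integral>\<^sup>+y. ennreal (\<integral>x. f x y \<partial>K y) \<partial>\<eta>)"
      using f_int f_le by (intro nn_integral_cong nn_integral_eq_integral) auto
    moreover have "\<dots> = ennreal (\<integral>y. \<integral>x. f x y \<partial>K y \<partial>\<eta>)"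
      using f_le calculation(1) by (intro nn_integral_eq_integral) (auto simp: integral_nonneg)
    ultimately show ?thesis by simp
  qed
  have "(\<integral>\<^sup>+(x, y). ennreal \<bar>g x y\<bar> \<partial>backward_prod \<eta> K) < \<infinity>"
    using part[OF gm(3)] by simp
  then show g_int: "integrable (backward_prod \<eta> K) (\<lambda>(x, y). g x y)"
    unfolding integrable_iff_bounded by (auto simp: case_prod_unfold)
  have "(\<integral>(x, y). g x y \<partial>backward_prod \<eta> K)
      = enn2real (\<integral>\<^sup>+(x, y). ennreal (max 0 (g x y)) \<partial>backward_prod \<eta> K)
        - enn2real (\<integral>\<^sup>+(x, y). ennreal (max 0 (- g x y)) \<partial>backward_prod \<eta> K)"
    using real_lebesgue_integral_def[OF g_int] by (simp add: case_prod_unfold ennreal_max_0)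
  also have "\<dots> = (\<integral>y. \<integral>x. max 0 (g x y) \<partial>K y \<partial>\<eta>) - (\<integral>y. \<integral>x. max 0 (- g x y) \<partial>K y \<partial>\<eta>)"
    using part[OF gm(1)] part[OF gm(2)] by (simp add: integral_nonneg)
  also have "\<dots> = (\<integral>y. (\<integral>x. max 0 (g x y) \<partial>K y) - (\<integral>x. max 0 (- g x y) \<partial>K y) \<partial>\<eta>)"
    using part[OF gm(1)] part[OF gm(2)] by simp
  also have "\<dots> = (\<integral>y. \<integral>x. g x y \<partial>K y \<partial>\<eta>)"
  proof (rule Bochner_Integration.integral_cong[OF refl])
    fix y
    have "(\<integral>x. max 0 (g x y) \<partial>K y) - (\<integral>x. max 0 (- g x y) \<partial>K y)
        = (\<integral>x. max 0 (g x y) - max 0 (- g x y) \<partial>K y)"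
      using int[of y] by simp
    also have "\<dots> = (\<integral>x. g x y \<partial>K y)"
      by (intro Bochner_Integration.integral_cong) auto
    finally show "(\<integral>x. max 0 (g x y) \<partial>K y) - (\<integral>x. max 0 (- g x y) \<partial>K y) = (\<integral>x. g x y \<partial>K y)" .
  qed
  finally show "(\<integral>(x, y). g x y \<partial>backward_prod \<eta> K) = (\<integral>y. \<integral>x. g x y \<partial>K y \<partial>\<eta>)" .
qed

end

text \<open>One half of the chain rule for relative entropy, in dual form.  The Donsker--Varadhan inequality
applies to \<open>g\<close> restricted to the set \<open>S n\<close> of those \<open>y\<close> at which the inner integral is
nonnegative and \<open>g\<close> has absolute moment at most \<open>n\<close>: cutting off in \<open>y\<close> keeps the exponential
constraint, because \<open>exp 0 = 1\<close>.  As \<open>n\<close> grows, these sets exhaust the \<open>y\<close> with nonnegative inner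
integral, and Fatou's lemma gives the bound on the positive part.\<close>

theorem rel_entropy_backward_prod_dual:
  fixes \<eta> :: "'a::topological_space measure" and g :: "'a \<Rightarrow> 'a \<Rightarrow> real"
  assumes \<eta>: "prob_space \<eta>" "sets \<eta> = sets borel" and L: "markov_kernel L" and K: "markov_kernel K"
    and g: "(\<lambda>(x, y). g x y) \<in> borel_measurable (borel \<Otimes>\<^sub>M borel)"
    and int: "\<And>y. integrable (L y) (\<lambda>x. g x y)"
    and exp_le: "\<And>y. (\<integral>\<^sup>+x. ennreal (exp (g x y)) \<partial>K y) \<le> 1"
  shows "(\<integral>\<^sup>+y. ennreal (\<integral>x. g x y \<partial>L y) \<partial>\<eta>) \<le> rel_entropy (backward_prod \<eta> L) (backward_prod \<eta> K)"
proof -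
  interpret prob_space \<eta> by (rule \<eta>)
  note [measurable_cong] = \<eta>(2)
  note g[measurable]
  define a where "a y = (\<integral>x. g x y \<partial>L y)" for y
  define b where "b y = (\<integral>x. \<bar>g x y\<bar> \<partial>L y)" for y
  have [measurable]: "a \<in> borel_measurable borel" "b \<in> borel_measurable borel"
    unfolding a_def[abs_def] b_def[abs_def] by (intro measurable_kernel_integral[OF L]; measurable)+
  define S where "S n = {y. 0 \<le> a y \<and> b y \<le> real n}" for n
  have [measurable]: "S n \<in> sets borel" for n
    unfolding S_def by measurable
  have le: "(\<integral>\<^sup>+y. ennreal (indicator (S n) y * a y) \<partial>\<eta>)
      \<le> rel_entropy (backward_prod \<eta> L) (backward_prod \<eta> K)" for n
  proof -
    define G where "G x y = indicator (S n) y * g x y" for x y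
    have Gm[measurable]: "(\<lambda>(x, y). G x y) \<in> borel_measurable (borel \<Otimes>\<^sub>M borel)"
      unfolding G_def by measurable
    have G_int: "integrable (L y) (\<lambda>x. G x y)" for y
      unfolding G_def using int by simp
    have G_bnd: "(\<integral>x. \<bar>G x y\<bar> \<partial>L y) \<le> real n" for y
      by (cases "y \<in> S n") (auto simp: G_def S_def b_def)
    have Ga: "(\<integral>x. G x y \<partial>L y) = indicator (S n) y * a y" for y
      by (simp add: G_def a_def)
    have "(\<integral>\<^sup>+y. ennreal (indicator (S n) y * a y) \<partial>\<eta>) = ennreal (\<integral>y. indicator (S n) y * a y \<partial>\<eta>)"
    proof (rule nn_integral_eq_integral)
      show "integrable \<eta> (\<lambda>y. indicator (S n) y * a y)"
      proof (rule integrable_const_bound[of _ "real n"])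
        have "norm (indicator (S n) y * a y) \<le> real n" for y
          unfolding Ga[symmetric] by (rule order_trans[OF integral_norm_bound]) (use G_bnd in simp)
        then show "AE y in \<eta>. norm (indicator (S n) y * a y) \<le> real n"
          by simp
      qed simp
    qed (auto simp: S_def indicator_def)
    also have "(\<integral>y. indicator (S n) y * a y \<partial>\<eta>) = (\<integral>(x, y). G x y \<partial>backward_prod \<eta> L)"
      unfolding Ga[symmetric] by (rule integral_backward_prod(2)[OF \<eta> L Gm G_int G_bnd, symmetric])
    also have "ennreal \<dots> \<le> rel_entropy (backward_prod \<eta> L) (backward_prod \<eta> K)"
    proof (rule Donsker_Varadhan)
      show "prob_space (backward_prod \<eta> L)" "prob_space (backward_prod \<eta> K)"
        by (rule prob_space_backward_prod[OF \<eta>]; fact)+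
      show "sets (backward_prod \<eta> L) = sets (backward_prod \<eta> K)"
        by (simp add: sets_backward_prod[OF \<eta>] L K)
      show "integrable (backward_prod \<eta> L) (\<lambda>(x, y). G x y)"
        by (rule integral_backward_prod(1)[OF \<eta> L Gm G_int G_bnd])
      have "(\<integral>\<^sup>+z. ennreal (exp ((\<lambda>(x, y). G x y) z)) \<partial>backward_prod \<eta> K)
          = (\<integral>\<^sup>+(x, y). ennreal (exp (G x y)) \<partial>backward_prod \<eta> K)"
        by (simp add: case_prod_unfold)
      also have "\<dots> = (\<integral>\<^sup>+y. \<integral>\<^sup>+x. ennreal (exp (G x y)) \<partial>K y \<partial>\<eta>)"
        by (rule nn_integral_backward_prod[OF \<eta> K]) measurable
      also have "\<dots> \<le> (\<integral>\<^sup>+y. 1 \<partial>\<eta>)"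
      proof (rule nn_integral_mono)
        fix y
        show "(\<integral>\<^sup>+x. ennreal (exp (G x y)) \<partial>K y) \<le> 1"
          using exp_le[of y] prob_space.emeasure_space_1[OF markov_kernelD(2)[OF K], of y]
          by (cases "y \<in> S n") (simp_all add: G_def)
      qed
      also have "\<dots> = 1"
        by (simp add: emeasure_space_1)
      finally show "(\<integral>\<^sup>+z. ennreal (exp ((\<lambda>(x, y). G x y) z)) \<partial>backward_prod \<eta> K) \<le> 1" .
    qed
    finally show ?thesis .
  qed
  have "(\<integral>\<^sup>+y. ennreal (a y) \<partial>\<eta>) = (\<integral>\<^sup>+y. liminf (\<lambda>n. ennreal (indicator (S n) y * a y)) \<partial>\<eta>)"
  proof (rule nn_integral_cong)
    fix y
    have "eventually (\<lambda>n. ennreal (indicator (S n) y * a y) = ennreal (a y)) sequentially"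
    proof (cases "0 \<le> a y")
      case True
      obtain m :: nat where "b y \<le> real m"
        using real_arch_simple by blast
      then have "\<forall>n\<ge>m. y \<in> S n"
        using True by (auto simp: S_def)
      then show ?thesis
        by (auto simp: eventually_sequentially intro!: exI[of _ m])
    qed (auto simp: S_def ennreal_neg)
    then have "(\<lambda>n. ennreal (indicator (S n) y * a y)) \<longlonglongrightarrow> ennreal (a y)"
      by (rule tendsto_eventually)
    then show "ennreal (a y) = liminf (\<lambda>n. ennreal (indicator (S n) y * a y))"
      by (intro lim_imp_Liminf[symmetric]) simp_all
  qed
  also have "\<dots> \<le> liminf (\<lambda>n. \<integral>\<^sup>+y. ennreal (indicator (S n) y * a y) \<partial>\<eta>)"
    by (rule nn_integral_liminf) simp
  also have "\<dots> \<le> liminf (\<lambda>n::nat. rel_entropy (backward_prod \<eta> L) (backward_prod \<eta> K))"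
    using le by (intro Liminf_mono always_eventually allI)
  also have "\<dots> = rel_entropy (backward_prod \<eta> L) (backward_prod \<eta> K)"
    by (simp add: Liminf_const)
  finally show ?thesis
    by (simp add: a_def)
qed

section \<open>Comparison of conditional means and covariances\<close>

lemma kernel_mean_measurable:
  assumes "markov_kernel K"
  shows "kernel_mean K \<in> borel_measurable borel"
  unfolding kernel_mean_def[abs_def] using assms by (rule measurable_kernel_integral) measurable

lemma kernel_cov_measurable:
  fixes K :: "real^'d \<Rightarrow> (real^'d) measure"
  assumes K: "markov_kernel K"
  shows "kernel_cov K \<in> borel_measurable borel"
proof -
  note kernel_mean_measurable[OF K, measurable]
  have "kernel_cov K = (\<lambda>y. \<integral>x. outer (x - kernel_mean K y) \<partial>K y)"
    by (simp add: kernel_cov_def outer_def fun_eq_iff)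
  then show ?thesis
    using K by (auto intro!: measurable_kernel_integral)
qed

text \<open>The minimiser \<open>r = sqrt (t/h)\<close> of the right-hand side is degenerate when \<open>h\<close> or \<open>t\<close> vanishes;
adding a small \<open>d\<close> to both square roots treats all cases at once.\<close>

lemma le_if_le_weighted:
  fixes h t \<xi> :: real
  assumes h: "0 \<le> h" "0 \<le> t" and le: "\<And>r. 0 < r \<Longrightarrow> \<xi> \<le> b + h * r + t / r"
  shows "\<xi> \<le> b + 2 * sqrt h * sqrt t"
proof (rule field_le_epsilon)
  fix e :: real assume e: "0 < e"
  define d where "d = e / (sqrt h + sqrt t + 1)"
  have roots: "0 \<le> sqrt h + sqrt t"
    using h by simp
  then have d: "0 < d"
    using e by (simp add: d_def)
  have "d * (sqrt h + sqrt t) \<le> d * (sqrt h + sqrt t + 1)"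
    using d by (intro mult_left_mono) auto
  also have "\<dots> = e"
    using roots by (simp add: d_def)
  finally have d_le: "d * (sqrt h + sqrt t) \<le> e" .
  have pos: "0 < sqrt h + d" "0 < sqrt t + d"
    using d h by (auto intro: add_nonneg_pos)
  have bnd: "u * ((sqrt w + d) / (sqrt u + d)) \<le> sqrt u * (sqrt w + d)" if u: "0 \<le> u" "0 \<le> w" for u w :: real
  proof -
    have "u / (sqrt u + d) \<le> sqrt u"
      using u d real_sqrt_mult_self[of u]
      by (simp add: pos_divide_le_eq add_nonneg_pos distrib_left)
    then have "u / (sqrt u + d) * (sqrt w + d) \<le> sqrt u * (sqrt w + d)"
      using u d by (intro mult_right_mono) auto
    then show ?thesis by simp
  qed
  have "\<xi> \<le> b + h * ((sqrt t + d) / (sqrt h + d)) + t / ((sqrt t + d) / (sqrt h + d))"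
    using pos by (intro le) simp
  also have "t / ((sqrt t + d) / (sqrt h + d)) = t * ((sqrt h + d) / (sqrt t + d))"
    by simp
  also have "b + h * ((sqrt t + d) / (sqrt h + d)) + t * ((sqrt h + d) / (sqrt t + d))
      \<le> b + sqrt h * (sqrt t + d) + sqrt t * (sqrt h + d)"
    using bnd[of h t] bnd[of t h] h by linarith
  also have "\<dots> = b + 2 * sqrt h * sqrt t + d * (sqrt h + sqrt t)"
    by (simp add: algebra_simps)
  finally show "\<xi> \<le> b + 2 * sqrt h * sqrt t + e"
    using d_le by linarith
qed

locale log_sobolev_kernels =
  fixes \<eta> :: "(real^'d) measure" and L K :: "real^'d \<Rightarrow> (real^'d) measure" and \<rho> :: real
  assumes \<eta>: "prob_space \<eta>" "sets \<eta> = sets borel"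
    and L: "markov_kernel L" "\<And>y. log_sobolev \<rho> (L y)"
    and K: "markov_kernel K" "\<And>y. log_sobolev \<rho> (K y)"
    and \<rho>: "0 < \<rho>"
begin

abbreviation "H \<equiv> rel_entropy (backward_prod \<eta> L) (backward_prod \<eta> K)"

lemmas LS_L = markov_kernelD(2,3)[OF L(1)] L(2) \<rho>
lemmas LS_K = markov_kernelD(2,3)[OF K(1)] K(2) \<rho>

lemmas [measurable] = kernel_mean_measurable[OF L(1)] kernel_mean_measurable[OF K(1)]
  kernel_cov_measurable[OF L(1)] kernel_cov_measurable[OF K(1)]

lemmas [measurable_cong] = \<eta>(2)

text \<open>The linear test function with direction \<open>v y\<close>, the difference of the means: its \<open>L y\<close>-integral is
\<open>(|v|\<^sup>2 - |v|\<^sup>2/2)/\<rho> = |v|\<^sup>2/(2 \<rho>)\<close>.\<close>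

lemma kernel_mean_bound:
  "(\<integral>\<^sup>+y. ennreal ((norm (kernel_mean K y - kernel_mean L y))\<^sup>2) \<partial>\<eta>) \<le> 2 * ennreal \<rho> * H"
proof -
  define v where "v y = kernel_mean L y - kernel_mean K y" for y
  have [measurable]: "v \<in> borel_measurable borel"
    unfolding v_def[abs_def] by measurable
  define g where "g x y = ((x - kernel_mean K y) \<bullet> v y - (norm (v y))\<^sup>2 / 2) / \<rho>" for x y
  have g_int: "integrable (L y) (\<lambda>x. g x y)" for y
  proof -
    interpret prob_space "L y" by (rule LS_L)
    show ?thesis
      unfolding g_def using log_sobolev_integrable_id[OF LS_L] by simp
  qed
  have "(\<integral>x. g x y \<partial>L y) = (norm (v y))\<^sup>2 / (2 * \<rho>)" for y
  proof -
    interpret prob_space "L y" by (rule LS_L)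
    have "(\<integral>x. g x y \<partial>L y) = (v y \<bullet> v y - (norm (v y))\<^sup>2 / 2) / \<rho>"
      unfolding g_def using log_sobolev_integrable_id[OF LS_L, of y]
      by (simp add: prob_space v_def kernel_mean_def del: inner_diff_left)
    then show ?thesis
      by (simp add: power2_norm_eq_inner)
  qed
  moreover have "(\<integral>\<^sup>+y. ennreal (\<integral>x. g x y \<partial>L y) \<partial>\<eta>) \<le> H"
  proof (rule rel_entropy_backward_prod_dual[OF \<eta> L(1) K(1) _ g_int])
    show "(\<lambda>(x, y). g x y) \<in> borel_measurable (borel \<Otimes>\<^sub>M borel)"
      unfolding g_def by measurable
    show "(\<integral>\<^sup>+x. ennreal (exp (g x y)) \<partial>K y) \<le> 1" for y
      using log_sobolev_exp_linear[OF LS_K, of y "v y"] by (simp add: g_def kernel_mean_def)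
  qed
  ultimately have le: "(\<integral>\<^sup>+y. ennreal ((norm (v y))\<^sup>2 / (2 * \<rho>)) \<partial>\<eta>) \<le> H"
    by simp
  have "(\<integral>\<^sup>+y. ennreal ((norm (kernel_mean K y - kernel_mean L y))\<^sup>2) \<partial>\<eta>)
      = (\<integral>\<^sup>+y. ennreal (2 * \<rho>) * ennreal ((norm (v y))\<^sup>2 / (2 * \<rho>)) \<partial>\<eta>)"
    using \<rho> by (intro nn_integral_cong) (simp add: ennreal_mult'[symmetric] v_def norm_minus_commute)
  also have "\<dots> = ennreal (2 * \<rho>) * (\<integral>\<^sup>+y. ennreal ((norm (v y))\<^sup>2 / (2 * \<rho>)) \<partial>\<eta>)"
    by (rule nn_integral_cmult) measurable
  also have "\<dots> \<le> ennreal (2 * \<rho>) * H"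
    using le by (rule mult_left_mono) simp
  finally show ?thesis
    using \<rho> by (simp add: ennreal_mult)
qed

text \<open>The quadratic test function centred at the mean \<open>c y\<close> of \<open>L y\<close>, with \<open>A y\<close> the normalised
difference \<open>D y\<close> of the covariances, so that \<open>A y \<bullet> D y = |D y|\<close>.  Its \<open>L y\<close>-integral \<open>a y\<close> is, up to
the factor \<open>s/(2 \<rho>)\<close>, the norm of \<open>D y\<close> minus \<open>(s/(1 - s)) Tr \<sigma>\<^sub>L\<close> and minus a term which
is at most the squared distance of the means, and which \<open>kernel_mean_bound\<close> controls.  With
\<open>s = 1/(1 + r)\<close> the coefficient \<open>s/(1 - s)\<close> becomes \<open>1/r\<close>.\<close>

lemma kernel_cov_bound_parametric:
  assumes r: "0 < r"
  shows "(\<integral>\<^sup>+y. ennreal (norm (kernel_cov K y - kernel_cov L y)) \<partial>\<eta>)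
    \<le> ennreal (2 * \<rho> * (1 + r)) * H + ennreal (1 / r) * (\<integral>\<^sup>+y. ennreal (trace (kernel_cov L y)) \<partial>\<eta>)
      + 2 * ennreal \<rho> * H"
proof -
  define s where "s = 1 / (1 + r)"
  have s: "0 < s" "s < 1"
    using r by (simp_all add: s_def)
  define D where "D y = kernel_cov L y - kernel_cov K y" for y
  define A where "A y = sgn (D y)" for y
  define c where "c = kernel_mean L"
  define \<Delta> where "\<Delta> y = kernel_mean K y - kernel_mean L y" for y
  have [measurable]: "D \<in> borel_measurable borel" "c \<in> borel_measurable borel" "\<Delta> \<in> borel_measurable borel"
    unfolding D_def[abs_def] c_def \<Delta>_def[abs_def] by measurable
  have [measurable]: "A \<in> borel_measurable borel"
    unfolding A_def[abs_def] sgn_div_norm by measurable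
  have A: "transpose (A y) = A y" "norm (A y) \<le> 1" for y
  proof -
    have "transpose (D y) = D y"
      using transpose_kernel_cov[where K = L and y = y and \<rho> = \<rho>, OF LS_L]
        transpose_kernel_cov[where K = K and y = y and \<rho> = \<rho>, OF LS_K]
      by (simp add: D_def transpose_def vec_eq_iff)
    then show "transpose (A y) = A y"
      by (simp add: A_def sgn_div_norm transpose_def vec_eq_iff)
    show "norm (A y) \<le> 1"
      by (simp add: A_def norm_sgn)
  qed
  have AD: "A y \<bullet> D y = norm (D y)" for y
    by (cases "D y = 0") (simp_all add: A_def sgn_div_norm power2_norm_eq_inner[symmetric] power2_eq_square)
  define p where "p y = (\<integral>x. s / 2 * ((x - c y) \<bullet> (A y *v (x - c y))) \<partial>K y)" for y
  have p: "p y = s / 2 * (A y \<bullet> kernel_cov K y + \<Delta> y \<bullet> (A y *v \<Delta> y))" for y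
    using inner_kernel_cov_shifted[where K = K and y = y and \<rho> = \<rho>, OF LS_K, of "c y" "A y"]
    by (simp add: p_def \<Delta>_def c_def)
  define g where "g x y = (s / 2 * ((x - c y) \<bullet> (A y *v (x - c y)))
      - (s\<^sup>2 / (1 - s)) / 2 * (norm (x - c y))\<^sup>2 - p y) / \<rho>" for x y
  define a where "a y = (\<integral>x. g x y \<partial>L y)" for y
  have int: "integrable (L y) (\<lambda>x. (x - c y) \<bullet> (A y *v (x - c y)))"
      "integrable (L y) (\<lambda>x. (norm (x - c y))\<^sup>2)" "integrable (L y) (\<lambda>x. p y)" for y
  proof -
    interpret prob_space "L y" by (rule LS_L)
    show "integrable (L y) (\<lambda>x. (x - c y) \<bullet> (A y *v (x - c y)))"
      "integrable (L y) (\<lambda>x. (norm (x - c y))\<^sup>2)" "integrable (L y) (\<lambda>x. p y)"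
      using log_sobolev_integrable_quadratic(2)[OF LS_L] log_sobolev_integrable_norm_square[OF LS_L] by simp_all
  qed
  have dual: "(\<integral>\<^sup>+y. ennreal (a y) \<partial>\<eta>) \<le> H"
    unfolding a_def
  proof (rule rel_entropy_backward_prod_dual[OF \<eta> L(1) K(1)])
    have [measurable]: "p \<in> borel_measurable borel"
      unfolding p_def[abs_def] inner_outer[symmetric]
      by (intro measurable_kernel_integral[OF K(1)]) measurable
    show "(\<lambda>(x, y). g x y) \<in> borel_measurable (borel \<Otimes>\<^sub>M borel)"
      unfolding g_def inner_outer[symmetric] by measurable
    show "integrable (L y) (\<lambda>x. g x y)" for y
      unfolding g_def using int by simp
    fix y
    have "(\<integral>\<^sup>+x. ennreal (exp (g x y)) \<partial>K y)
        = (\<integral>\<^sup>+x. ennreal (exp (- (p y / \<rho>))) * ennreal (exp ((s / 2 * ((x - c y) \<bullet> (A y *v (x - c y)))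
            - (s\<^sup>2 / (1 - s)) / 2 * (norm (x - c y))\<^sup>2) / \<rho>)) \<partial>K y)"
      unfolding g_def
      by (intro nn_integral_cong) (simp add: ennreal_mult[symmetric] exp_add[symmetric] diff_divide_distrib)
    also have "\<dots> = ennreal (exp (- (p y / \<rho>))) * (\<integral>\<^sup>+x. ennreal (exp ((s / 2 * ((x - c y) \<bullet> (A y *v (x - c y)))
            - (s\<^sup>2 / (1 - s)) / 2 * (norm (x - c y))\<^sup>2) / \<rho>)) \<partial>K y)"
    proof (rule nn_integral_cmult)
      note [measurable_cong] = LS_K(2)
      show "(\<lambda>x. ennreal (exp ((s / 2 * ((x - c y) \<bullet> (A y *v (x - c y)))
            - (s\<^sup>2 / (1 - s)) / 2 * (norm (x - c y))\<^sup>2) / \<rho>))) \<in> borel_measurable (K y)"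
        unfolding inner_outer[symmetric] by measurable
    qed
    also have "\<dots> \<le> ennreal (exp (- (p y / \<rho>))) * ennreal (exp (p y / \<rho>))"
      using log_sobolev_exp_quadratic[OF LS_K A s, of y "c y"]
      by (intro mult_left_mono) (auto simp: p_def)
    also have "\<dots> = 1"
      by (simp add: ennreal_mult[symmetric] exp_add[symmetric])
    finally show "(\<integral>\<^sup>+x. ennreal (exp (g x y)) \<partial>K y) \<le> 1" .
  qed
  have a: "a y = (s / 2 * (norm (D y) - \<Delta> y \<bullet> (A y *v \<Delta> y)) - (s\<^sup>2 / (1 - s)) / 2 * trace (kernel_cov L y)) / \<rho>" for y
  proof -
    interpret prob_space "L y" by (rule LS_L)
    have "a y = (s / 2 * (A y \<bullet> kernel_cov L y) - (s\<^sup>2 / (1 - s)) / 2 * trace (kernel_cov L y) - p y) / \<rho>"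
      unfolding a_def g_def using int[of y]
      by (simp add: c_def prob_space trace_kernel_cov(1)[where K = L and y = y and \<rho> = \<rho>, OF LS_L]
        inner_kernel_cov[where K = L and y = y and \<rho> = \<rho>, OF LS_L])
    moreover have "norm (D y) = A y \<bullet> kernel_cov L y - A y \<bullet> kernel_cov K y"
      unfolding AD[symmetric] by (simp add: D_def inner_diff_right)
    ultimately show ?thesis
      unfolding p by (simp only:) (simp add: algebra_simps)
  qed
  have trace_nonneg: "0 \<le> trace (kernel_cov L y)" for y
    using trace_kernel_cov(2)[where K = L and y = y and \<rho> = \<rho>, OF LS_L] .
  have pointwise: "ennreal (norm (kernel_cov K y - kernel_cov L y))
      \<le> ennreal (2 * \<rho> * (1 + r)) * ennreal (a y) + ennreal (1 / r) * ennreal (trace (kernel_cov L y))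
        + ennreal ((norm (\<Delta> y))\<^sup>2)" for y
  proof -
    have 1: "2 * \<rho> * (1 + r) * a y = norm (D y) - \<Delta> y \<bullet> (A y *v \<Delta> y) - 1 / r * trace (kernel_cov L y)"
    proof -
      have "1 - s = s * r"
        using r by (simp add: s_def field_simps)
      then have "s\<^sup>2 / (1 - s) = s / r"
        using s by (simp add: power2_eq_square)
      then have "2 * \<rho> * (1 + r) * a y
          = (s * (1 + r)) * (norm (D y) - \<Delta> y \<bullet> (A y *v \<Delta> y)) - (s * (1 + r)) * (1 / r * trace (kernel_cov L y))"
        unfolding a using \<rho> by (simp add: field_simps)
      also have "s * (1 + r) = 1"
        using r by (simp add: s_def)
      finally show ?thesis by simp
    qed
    have "\<Delta> y \<bullet> (A y *v \<Delta> y) \<le> norm (\<Delta> y) * norm (A y *v \<Delta> y)"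
      by (rule norm_cauchy_schwarz)
    also have "\<dots> \<le> norm (\<Delta> y) * (1 * norm (\<Delta> y))"
      using A(2)[of y]
      by (intro mult_left_mono order_trans[OF norm_matrix_vector_mult_le] mult_right_mono) auto
    finally have 2: "\<Delta> y \<bullet> (A y *v \<Delta> y) \<le> (norm (\<Delta> y))\<^sup>2"
      by (simp add: power2_eq_square)
    \<comment> \<open>Coercion to \<open>ennreal\<close> sends negative values of \<open>a y\<close> to \<open>0\<close>, so only the positive part may be split off.\<close>
    have "2 * \<rho> * (1 + r) * a y \<le> 2 * \<rho> * (1 + r) * max 0 (a y)"
      using \<rho> r by (intro mult_left_mono) auto
    then have "norm (D y) \<le> 2 * \<rho> * (1 + r) * max 0 (a y) + 1 / r * trace (kernel_cov L y) + (norm (\<Delta> y))\<^sup>2"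
      using 1 2 by linarith
    then have "ennreal (norm (D y))
        \<le> ennreal (2 * \<rho> * (1 + r) * max 0 (a y) + 1 / r * trace (kernel_cov L y) + (norm (\<Delta> y))\<^sup>2)"
      by (rule ennreal_leI)
    also have "\<dots> = ennreal (2 * \<rho> * (1 + r) * max 0 (a y)) + ennreal (1 / r * trace (kernel_cov L y))
        + ennreal ((norm (\<Delta> y))\<^sup>2)"
      using \<rho> r trace_nonneg by (simp add: ennreal_plus)
    also have "ennreal (2 * \<rho> * (1 + r) * max 0 (a y)) = ennreal (2 * \<rho> * (1 + r)) * ennreal (a y)"
      using \<rho> r by (subst ennreal_mult') (auto simp: ennreal_max_0)
    also have "ennreal (1 / r * trace (kernel_cov L y)) = ennreal (1 / r) * ennreal (trace (kernel_cov L y))"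
      using r by (subst ennreal_mult') auto
    finally show ?thesis
      by (simp add: D_def norm_minus_commute)
  qed
  have [measurable]: "a \<in> borel_measurable borel" "(\<lambda>y. trace (kernel_cov L y)) \<in> borel_measurable borel"
    unfolding a[abs_def] inner_outer[symmetric] trace_eq_inner by measurable
  have "(\<integral>\<^sup>+y. ennreal (norm (kernel_cov K y - kernel_cov L y)) \<partial>\<eta>)
      \<le> (\<integral>\<^sup>+y. ennreal (2 * \<rho> * (1 + r)) * ennreal (a y) + ennreal (1 / r) * ennreal (trace (kernel_cov L y))
        + ennreal ((norm (\<Delta> y))\<^sup>2) \<partial>\<eta>)"
    using pointwise by (intro nn_integral_mono)
  also have "\<dots> = ennreal (2 * \<rho> * (1 + r)) * (\<integral>\<^sup>+y. ennreal (a y) \<partial>\<eta>)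
      + ennreal (1 / r) * (\<integral>\<^sup>+y. ennreal (trace (kernel_cov L y)) \<partial>\<eta>)
      + (\<integral>\<^sup>+y. ennreal ((norm (\<Delta> y))\<^sup>2) \<partial>\<eta>)"
    by (simp add: nn_integral_add nn_integral_cmult)
  also have "\<dots> \<le> ennreal (2 * \<rho> * (1 + r)) * H
      + ennreal (1 / r) * (\<integral>\<^sup>+y. ennreal (trace (kernel_cov L y)) \<partial>\<eta>) + 2 * ennreal \<rho> * H"
    using dual kernel_mean_bound unfolding \<Delta>_def
    by (intro add_mono mult_left_mono order_refl) auto
  finally show ?thesis .
qed

text \<open>For finite entropy, optimise over \<open>r\<close>.  The averaged trace is finite by the uniform second moment
bound, which allows the optimisation to be carried out in the reals.\<close>

lemma kernel_cov_bound:
  "(\<integral>\<^sup>+y. ennreal (norm (kernel_cov K y - kernel_cov L y)) \<partial>\<eta>)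
    \<le> 4 * ennreal \<rho> * H + cov_const \<eta> L * ennreal_sqrt (8 * ennreal \<rho> * H)"
proof (cases H rule: ennreal_cases)
  case (real h)
  interpret prob_space \<eta> by (rule \<eta>)
  define T where "T = (\<integral>\<^sup>+y. ennreal (trace (kernel_cov L y)) \<partial>\<eta>)"
  define X where "X = (\<integral>\<^sup>+y. ennreal (norm (kernel_cov K y - kernel_cov L y)) \<partial>\<eta>)"
  have "T \<le> (\<integral>\<^sup>+y. ennreal (real CARD('d) * (4 * exp (\<rho> / 2))) \<partial>\<eta>)"
    unfolding T_def using trace_kernel_cov(3)[where K = L and \<rho> = \<rho>, OF LS_L]
    by (intro nn_integral_mono ennreal_leI)
  also have "\<dots> < \<infinity>"
    by (simp add: emeasure_space_1)
  finally obtain t where t: "T = ennreal t" "0 \<le> t"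
    by (cases T rule: ennreal_cases) auto
  have X_le: "X \<le> ennreal (2 * (2 * \<rho> * h) + 2 * \<rho> * h * r + t / r)" if r: "0 < r" for r
  proof -
    have "X \<le> ennreal (2 * \<rho> * (1 + r)) * ennreal h + ennreal (1 / r) * ennreal t + 2 * ennreal \<rho> * ennreal h"
      using kernel_cov_bound_parametric[OF r] by (simp only: X_def T_def[symmetric] t real)
    also have "\<dots> = ennreal (2 * \<rho> * (1 + r) * h + 1 / r * t + 2 * \<rho> * h)"
    proof -
      have "ennreal (2 * \<rho> * (1 + r)) * ennreal h = ennreal (2 * \<rho> * (1 + r) * h)"
        "ennreal (1 / r) * ennreal t = ennreal (1 / r * t)"
        using real t by (simp_all only: ennreal_mult'')
      moreover have "2 * ennreal \<rho> * ennreal h = ennreal (2 * \<rho> * h)"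
        using \<rho> real by (simp add: ennreal_mult)
      ultimately show ?thesis
        using \<rho> r real t by (simp add: ennreal_plus)
    qed
    finally show ?thesis
      by (simp add: algebra_simps)
  qed
  have "X < \<infinity>"
    using le_less_trans[OF X_le[of 1], of \<infinity>] by simp
  then obtain \<xi> where \<xi>: "X = ennreal \<xi>" "0 \<le> \<xi>"
    by (cases X rule: ennreal_cases) auto
  have "\<xi> \<le> 2 * (2 * \<rho> * h) + 2 * sqrt (2 * \<rho> * h) * sqrt t"
  proof (rule le_if_le_weighted)
    fix r :: real assume r: "0 < r"
    have "0 \<le> 2 * (2 * \<rho> * h) + 2 * \<rho> * h * r + t / r"
      using \<rho> real t r by simp
    then show "\<xi> \<le> 2 * (2 * \<rho> * h) + 2 * \<rho> * h * r + t / r"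
      using X_le[OF r] by (simp add: \<xi> ennreal_le_iff)
  qed (use \<rho> real t in auto)
  also have "2 * sqrt (2 * \<rho> * h) = sqrt (8 * \<rho> * h)"
    using real_sqrt_mult[of 4 "2 * \<rho> * h"] by (simp add: mult.assoc)
  finally have "\<xi> \<le> 4 * \<rho> * h + sqrt t * sqrt (8 * \<rho> * h)"
    by (simp add: mult.commute[of "sqrt t"] mult.assoc)
  then have "X \<le> ennreal (4 * \<rho> * h + sqrt t * sqrt (8 * \<rho> * h))"
    unfolding \<xi> by (rule ennreal_leI)
  also have "\<dots> = 4 * ennreal \<rho> * ennreal h + ennreal (sqrt t) * ennreal (sqrt (8 * \<rho> * h))"
    using \<rho> real t by (simp add: ennreal_plus ennreal_mult)
  also have "ennreal (sqrt t) = cov_const \<eta> L"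
    using t by (simp add: cov_const_def ennreal_sqrt_def T_def)
  also have "ennreal (sqrt (8 * \<rho> * h)) = ennreal_sqrt (8 * ennreal \<rho> * ennreal h)"
  proof -
    have "8 * ennreal \<rho> * ennreal h = ennreal (8 * \<rho> * h)"
      using \<rho> real by (simp add: ennreal_mult)
    then show ?thesis
      using \<rho> real by (simp add: ennreal_sqrt_def)
  qed
  finally show ?thesis
    by (simp add: X_def real)
next
  case top
  then show ?thesis
    using \<rho> by (simp add: ennreal_mult_top)
qed

end

section \<open>Sinkhorn bridges\<close>

theorem corollary4p3:
  fixes \<tau> \<beta> :: "real^'d^'d" and \<alpha> :: "real^'d"
    and U V :: "real^'d \<Rightarrow> real"
    and a\<^sub>u a\<^sub>v b\<^sub>u b\<^sub>v \<delta>\<^sub>u \<delta>\<^sub>v \<rho>\<^sub>u :: real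
    and \<mu> \<eta> :: "(real^'d) measure"
    and K\<^sub>W L :: "real^'d \<Rightarrow> (real^'d) measure"
    and P P_bridge :: "((real^'d) \<times> (real^'d)) measure"
    and K :: "nat \<Rightarrow> real^'d \<Rightarrow> (real^'d) measure"
    and n :: nat
  assumes tau: "pos_definite \<tau>"
    and beta: "invertible \<beta>"
    and K\<^sub>W: "K\<^sub>W = potential_kernel (gauss_potential \<tau> \<alpha> \<beta>)"
    and \<mu>: "\<mu> = gibbs_measure U" "prob_space \<mu>"
    and \<eta>: "\<eta> = gibbs_measure V" "prob_space \<eta>"
    and diff: "twice_differentiable U" "twice_differentiable V"
    and params: "0 < a\<^sub>u" "0 < a\<^sub>v" "0 \<le> b\<^sub>u" "0 \<le> b\<^sub>v" "0 \<le> \<delta>\<^sub>u" "0 \<le> \<delta>\<^sub>v"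
    and curv: "curvature_bound a\<^sub>u b\<^sub>u \<delta>\<^sub>u U" "curvature_bound a\<^sub>v b\<^sub>v \<delta>\<^sub>v V"
    and P: "P = forward_prod \<mu> K\<^sub>W"
    and finite_entropy: "\<exists>Q\<in>couplings \<mu> \<eta>. rel_entropy Q P < \<infinity>"
    and bridge: "schroedinger_bridge \<mu> \<eta> P P_bridge"
    and L: "markov_kernel L" "P_bridge = backward_prod \<eta> L"
    and sinkhorn: "sinkhorn_kernels \<mu> \<eta> K\<^sub>W K"
    and rho: "0 < \<rho>\<^sub>u" "log_sobolev \<rho>\<^sub>u \<mu>" "\<forall>y. log_sobolev \<rho>\<^sub>u (L y)"
      "\<forall>k y. log_sobolev \<rho>\<^sub>u (K (2 * k + 1) y)"
  shows "(\<integral>\<^sup>+y. ennreal ((norm (kernel_mean (K (2 * n + 1)) y - kernel_mean L y))\<^sup>2) \<partial>\<eta>)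
           \<le> 2 * ennreal \<rho>\<^sub>u * rel_entropy P_bridge (sinkhorn_bridge \<mu> \<eta> K (2 * n + 1))
       \<and> (\<integral>\<^sup>+y. ennreal (frobenius_norm (kernel_cov (K (2 * n + 1)) y - kernel_cov L y)) \<partial>\<eta>)
           \<le> 4 * ennreal \<rho>\<^sub>u * rel_entropy P_bridge (sinkhorn_bridge \<mu> \<eta> K (2 * n + 1))
             + cov_const \<eta> L
               * ennreal_sqrt
                   (8 * ennreal \<rho>\<^sub>u
                      * rel_entropy P_bridge (sinkhorn_bridge \<mu> \<eta> K (2 * n + 1)))"
proof -
  have sets_\<eta>: "sets \<eta> = sets borel"
    by (simp add: \<eta>(1) gibbs_measure_def)
  have "backward_conditional (sinkhorn_bridge \<mu> \<eta> K (2 * n)) (K (2 * n + 1))"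
    using sinkhorn unfolding sinkhorn_kernels_def by (elim conjE allE[where x = n])
  then have K: "markov_kernel (K (2 * n + 1))"
    unfolding backward_conditional_def by (rule conjunct1)
  have LS: "log_sobolev \<rho>\<^sub>u (L y)" "log_sobolev \<rho>\<^sub>u (K (2 * n + 1) y)" for y
    by (rule spec[OF rho(3)], rule rho(4)[rule_format])
  note P_bridge = L(2)
  interpret log_sobolev_kernels \<eta> L "K (2 * n + 1)" \<rho>\<^sub>u
    by (rule log_sobolev_kernels.intro[OF \<eta>(2) sets_\<eta> L(1) LS(1) K LS(2) rho(1)])
  have odd: "sinkhorn_bridge \<mu> \<eta> K (2 * n + 1) = backward_prod \<eta> (K (2 * n + 1))"
    by (simp add: sinkhorn_bridge_def)
  show ?thesis
    unfolding odd P_bridge frobenius_norm_eq_norm using kernel_mean_bound kernel_cov_bound by (rule conjI)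
qed

end
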